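(* Let $\mathcal X$, $\mu$, $(B,\|\cdot\|)$, $\mathcal L$, $h_0$, $(U_j)_{j\ge1}$ be as in the context, let $f\in B$ be real-valued with $\mu(f)=0$, set $S_n=\sum_{j=1}^n f(U_j)$ and $\mathcal L_z(g)=\mathcal L(e^{zf}g)$ for $z\in\mathbb C$, and assume $\sigma^2=\lim_{n\to\infty}\frac1n\mathrm{Var}(S_n)>0$. Suppose that $z\mapsto\mathcal L_z$ is well defined and analytic (with values in bounded operators on $B$) in a complex neighborhood of the origin, that $\mathcal L$ is quasi-compact with spectral radius $1$, and that, up to a multiplicative constant, $h_0$ is the unique eigenfunction of $\mathcal L$ corresponding to an eigenvalue of modulus one. Then there are functions $\Pi(z)$, $U(z)$, $\delta_n(z)$ ($n\ge1$), analytic in a common complex neighborhood of $0$, and constants $C>0$, $\delta\in(0,1)$ such that: $\Pi(0)=0$, $\Pi''(0)>0$, $U(0)=1$; $|\delta_n(z)|\le C\delta^n$; and $$\mathbb E[e^{zS_n}]=e^{n\Pi(z)}\left(U(z)+\delta_n(z)\right)$$ for all $n\ge1$ and all $z$ in this neighborhood.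
   Context: Setting: $(B,\|\cdot\|)$ is a (complex) Banach space of functions on a measurable space $\mathcal X$ which contains the constant functions; $\mu$ is a probability measure on $\mathcal X$ with $\|g\|\ge\|g\|_{L^1(\mu)}$ for $g\in B$, and $\mu$, viewed as a linear functional, belongs to the dual $B^*$; there is $C>0$ with $\|fg\|\le C\|f\|\|g\|$ for all $f,g\in B$. $\mathcal L$ is a bounded linear operator on $B$ with $\mathcal L^*\mu=\mu$; $h_0\in B$ is positive with $\mu(h_0)=1$ and $\mathcal Lh_0=h_0$; $(U_j)_{j\ge1}$ are $\mathcal X$-valued random variables such that for all $n$ and all $f_1,\dots,f_n\in B$, $$\mathbb E\Big[\prod_{j=1}^n f_j(U_j)\Big]=\mu\left(\mathcal L_{f_n}\circ\cdots\circ\mathcal L_{f_2}\circ\mathcal L_{f_1}h_0\right),\qquad \mathcal L_{f_j}(g):=\mathcal L(f_jg).$$ *)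

theory Defs
  imports "HOL-Probability.Probability" "HOL-Complex_Analysis.Complex_Analysis"
begin

text \<open>
  The measurable space is a type \<open>'x\<close> (with the sigma-algebra carried by a measure on it), and a
  complex Banach space of functions is a set \<open>B\<close> of functions \<open>'x \<Rightarrow> complex\<close> together with a norm
  \<open>nrm\<close> that is only constrained on \<open>B\<close>.  Elements of \<open>B\<close> are genuine functions, not classes modulo
  null sets.  Likewise an operator on \<open>B\<close> is a map whose values outside \<open>B\<close> are irrelevant.
\<close>

locale function_banach_space =
  fixes B :: "('x \<Rightarrow> complex) set"
    and nrm :: "('x \<Rightarrow> complex) \<Rightarrow> real"
  assumes zero_mem: "(\<lambda>x. 0) \<in> B"
    and add_mem: "\<lbrakk>g \<in> B; h \<in> B\<rbrakk> \<Longrightarrow> (\<lambda>x. g x + h x) \<in> B"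
    and scale_mem: "g \<in> B \<Longrightarrow> (\<lambda>x. c * g x) \<in> B"
    and nrm_nonneg: "g \<in> B \<Longrightarrow> 0 \<le> nrm g"
    and nrm_eq_0: "g \<in> B \<Longrightarrow> nrm g = 0 \<longleftrightarrow> g = (\<lambda>x. 0)"
    and nrm_triangle: "\<lbrakk>g \<in> B; h \<in> B\<rbrakk> \<Longrightarrow> nrm (\<lambda>x. g x + h x) \<le> nrm g + nrm h"
    and nrm_scale: "g \<in> B \<Longrightarrow> nrm (\<lambda>x. c * g x) = cmod c * nrm g"
    and complete: "\<lbrakk>\<And>n. s n \<in> B;
        \<And>e. e > 0 \<Longrightarrow> \<exists>K. \<forall>m\<ge>K. \<forall>n\<ge>K. nrm (\<lambda>x. s m x - s n x) < e\<rbrakk>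
      \<Longrightarrow> \<exists>g\<in>B. (\<lambda>n. nrm (\<lambda>x. s n x - g x)) \<longlonglongrightarrow> 0"

type_synonym 'x fun_op = "('x \<Rightarrow> complex) \<Rightarrow> ('x \<Rightarrow> complex)"

definition bounded_op ::
  "('x \<Rightarrow> complex) set \<Rightarrow> (('x \<Rightarrow> complex) \<Rightarrow> real) \<Rightarrow> 'x fun_op \<Rightarrow> bool" where
  "bounded_op B nrm T \<longleftrightarrow>
     (\<forall>g\<in>B. T g \<in> B) \<and>
     (\<forall>g\<in>B. \<forall>h\<in>B. T (\<lambda>x. g x + h x) = (\<lambda>x. T g x + T h x)) \<and>
     (\<forall>c. \<forall>g\<in>B. T (\<lambda>x. c * g x) = (\<lambda>x. c * T g x)) \<and>
     (\<exists>K. \<forall>g\<in>B. nrm (T g) \<le> K * nrm g)"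

definition op_norm ::
  "('x \<Rightarrow> complex) set \<Rightarrow> (('x \<Rightarrow> complex) \<Rightarrow> real) \<Rightarrow> 'x fun_op \<Rightarrow> real" where
  "op_norm B nrm T = Sup {nrm (T g) | g. g \<in> B \<and> nrm g \<le> 1}"

definition compact_op ::
  "('x \<Rightarrow> complex) set \<Rightarrow> (('x \<Rightarrow> complex) \<Rightarrow> real) \<Rightarrow> 'x fun_op \<Rightarrow> bool" where
  "compact_op B nrm T \<longleftrightarrow>
     bounded_op B nrm T \<and>
     (\<forall>s. (\<forall>n. s n \<in> B \<and> nrm (s n) \<le> 1) \<longrightarrow>
        (\<exists>g\<in>B. \<exists>r :: nat \<Rightarrow> nat. strict_mono r \<and>
           (\<lambda>n. nrm (\<lambda>x. T (s (r n)) x - g x)) \<longlonglongrightarrow> 0))"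

definition op_spectrum ::
  "('x \<Rightarrow> complex) set \<Rightarrow> (('x \<Rightarrow> complex) \<Rightarrow> real) \<Rightarrow> 'x fun_op \<Rightarrow> complex set" where
  "op_spectrum B nrm T =
     {l. \<not> (\<exists>R. bounded_op B nrm R \<and>
             (\<forall>g\<in>B. R (\<lambda>x. l * g x - T g x) = g \<and> (\<lambda>x. l * R g x - T (R g) x) = g))}"

definition op_spectral_radius ::
  "('x \<Rightarrow> complex) set \<Rightarrow> (('x \<Rightarrow> complex) \<Rightarrow> real) \<Rightarrow> 'x fun_op \<Rightarrow> real" where
  "op_spectral_radius B nrm T = (SUP l\<in>op_spectrum B nrm T. cmod l)"

text \<open>
  Quasi-compactness: some power of \<open>T\<close> is closer than \<open>r(T)\<^sup>n\<close> to a compact operator; this says that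
  the essential spectral radius of \<open>T\<close> is smaller than its spectral radius \<open>r(T)\<close>.
\<close>

definition quasi_compact ::
  "('x \<Rightarrow> complex) set \<Rightarrow> (('x \<Rightarrow> complex) \<Rightarrow> real) \<Rightarrow> 'x fun_op \<Rightarrow> bool" where
  "quasi_compact B nrm T \<longleftrightarrow>
     (\<exists>n\<ge>1. \<exists>K. compact_op B nrm K \<and>
        op_norm B nrm (\<lambda>g x. (T ^^ n) g x - K g x) < op_spectral_radius B nrm T ^ n)"

definition eigenfunction ::
  "('x \<Rightarrow> complex) set \<Rightarrow> 'x fun_op \<Rightarrow> complex \<Rightarrow> ('x \<Rightarrow> complex) \<Rightarrow> bool" where
  "eigenfunction B T l g \<longleftrightarrow> g \<in> B \<and> g \<noteq> (\<lambda>x. 0) \<and> T g = (\<lambda>x. l * g x)"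

text \<open>
  Analyticity, on an open set \<open>V\<close>, of a family of bounded operators: complex differentiability in
  operator norm, as in the library's \<open>holomorphic_on\<close> for scalar functions.
\<close>

definition op_analytic_on ::
  "('x \<Rightarrow> complex) set \<Rightarrow> (('x \<Rightarrow> complex) \<Rightarrow> real) \<Rightarrow> (complex \<Rightarrow> 'x fun_op) \<Rightarrow> complex set \<Rightarrow> bool"
  where
  "op_analytic_on B nrm T V \<longleftrightarrow>
     (\<forall>z\<in>V. bounded_op B nrm (T z)) \<and>
     (\<forall>z\<in>V. \<exists>D. bounded_op B nrm D \<and>
        ((\<lambda>w. op_norm B nrm (\<lambda>g x. (T w g x - T z g x) / (w - z) - D g x)) \<longlongrightarrow> 0) (at z))"

text \<open>\<open>op_chain L F h n\<close> is \<open>L\<^bsub>F n\<^esub> (\<dots> (L\<^bsub>F 2\<^esub> (L\<^bsub>F 1\<^esub> h)))\<close>, where \<open>L\<^bsub>F j\<^esub> g = L (F j \<cdot> g)\<close>.\<close>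

primrec op_chain ::
  "'x fun_op \<Rightarrow> (nat \<Rightarrow> 'x \<Rightarrow> complex) \<Rightarrow> ('x \<Rightarrow> complex) \<Rightarrow> nat \<Rightarrow> ('x \<Rightarrow> complex)" where
  "op_chain L F h 0 = h"
| "op_chain L F h (Suc n) = L (\<lambda>x. F (Suc n) x * op_chain L F h n x)"

text \<open>
  The underlying probability space of the random variables is \<open>P\<close>, and only \<open>U j\<close> with \<open>j \<ge> 1\<close>
  matter.  Integrability is stated next to each integral since the integral of a non-integrable
  function is \<open>0\<close> by convention.
\<close>

locale transfer_operator_setting =
  function_banach_space B nrm + mu: prob_space mu + P: prob_space P
  for B :: "('x \<Rightarrow> complex) set" and nrm :: "('x \<Rightarrow> complex) \<Rightarrow> real"
    and mu :: "'x measure" and P :: "'w measure" +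
  fixes L :: "'x fun_op" and h0 :: "'x \<Rightarrow> complex" and U :: "nat \<Rightarrow> 'w \<Rightarrow> 'x"
  assumes space_mu: "space mu = UNIV"
    and const_mem: "(\<lambda>x. c) \<in> B"
    and B_integrable: "g \<in> B \<Longrightarrow> integrable mu g"
    and nrm_ge_L1: "g \<in> B \<Longrightarrow> (\<integral>x. cmod (g x) \<partial>mu) \<le> nrm g"
    and mu_dual: "\<exists>K. \<forall>g\<in>B. cmod (\<integral>x. g x \<partial>mu) \<le> K * nrm g"
    and mult_mem: "\<lbrakk>g \<in> B; h \<in> B\<rbrakk> \<Longrightarrow> (\<lambda>x. g x * h x) \<in> B"
    and nrm_mult: "\<exists>C>0. \<forall>g\<in>B. \<forall>h\<in>B. nrm (\<lambda>x. g x * h x) \<le> C * nrm g * nrm h"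
    and L_bounded: "bounded_op B nrm L"
    and L_mu: "g \<in> B \<Longrightarrow> (\<integral>x. L g x \<partial>mu) = (\<integral>x. g x \<partial>mu)"
    and h0_mem: "h0 \<in> B"
    and h0_pos: "h0 x \<in> \<real> \<and> 0 < Re (h0 x)"
    and h0_mu: "(\<integral>x. h0 x \<partial>mu) = 1"
    and L_h0: "L h0 = h0"
    and U_measurable: "j \<ge> 1 \<Longrightarrow> U j \<in> measurable P mu"
    and U_integrable: "\<lbrakk>n \<ge> 1; \<And>j. j \<in> {1..n} \<Longrightarrow> F j \<in> B\<rbrakk>
      \<Longrightarrow> integrable P (\<lambda>\<omega>. \<Prod>j=1..n. F j (U j \<omega>))"
    and U_expectation: "\<lbrakk>n \<ge> 1; \<And>j. j \<in> {1..n} \<Longrightarrow> F j \<in> B\<rbrakk>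
      \<Longrightarrow> P.expectation (\<lambda>\<omega>. \<Prod>j=1..n. F j (U j \<omega>)) = (\<integral>x. op_chain L F h0 n x \<partial>mu)"

definition twisted_op :: "'x fun_op \<Rightarrow> ('x \<Rightarrow> real) \<Rightarrow> complex \<Rightarrow> 'x fun_op" where
  "twisted_op L f z g = L (\<lambda>x. exp (z * of_real (f x)) * g x)"

definition partial_sum :: "('x \<Rightarrow> real) \<Rightarrow> (nat \<Rightarrow> 'w \<Rightarrow> 'x) \<Rightarrow> nat \<Rightarrow> 'w \<Rightarrow> real" where
  "partial_sum f U n \<omega> = (\<Sum>j=1..n. f (U j \<omega>))"

end

theory Submission
  imports Defs
begin

text \<open>
  Write \<open>\<L>\<^sub>z = N\<^sub>z + h\<^sub>0 \<otimes> \<mu>\<close> with the fixed rank-one operator \<open>h\<^sub>0 \<otimes> \<mu>\<close>.  Then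
  \<open>A\<^sub>0 = 1\<close>, \<open>A\<^bsub>n+1\<^esub> = \<mu>(\<L>\<^sub>z\<^sup>n h\<^sub>0) = \<bbbE>[e\<^bsup>zS\<^esup>]\<close> (with \<open>S = S\<^sub>n\<close>) is a renewal sequence,
  \<open>A\<^bsub>n+1\<^esub> = \<Sum>k\<le>n. b\<^sub>k A\<^bsub>n-k\<^esub>\<close> with \<open>b\<^sub>k = \<mu>(N\<^sub>z\<^sup>k h\<^sub>0)\<close> and \<open>b\<^sub>0 = 1\<close>.  Since \<open>N\<^sub>0\<close> acts like
  \<open>\<L>\<close> on \<open>ker \<mu>\<close>, where \<open>\<L>\<close> has no eigenvalue of modulus at least \<open>1\<close>, quasi-compactness makes
  \<open>N\<^sub>z\<^sup>k\<close> decay geometrically, uniformly for small \<open>z\<close>; moreover \<open>N\<^sub>0 h\<^sub>0 = 0\<close>, so that \<open>b\<^sub>k\<close> is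
  small for \<open>k \<ge> 1\<close>.  For such \<open>b\<close> the ratios \<open>A\<^bsub>n+1\<^esub> / A\<^sub>n\<close> converge geometrically to some
  \<open>\<lambda>(z)\<close> near \<open>1\<close>, and then so does \<open>A\<^sub>n / \<lambda>(z)\<^sup>n\<close>; both limits are holomorphic because the
  convergence is uniform.  One takes \<open>\<Pi> = Ln \<lambda>\<close>, and \<open>\<Pi>''(0) = \<sigma>\<^sup>2\<close> follows by differentiating
  \<open>\<bbbE>[e\<^bsup>zS\<^esup>]\<close> twice at \<open>0\<close>, the factor \<open>U + \<delta>\<^sub>n\<close> having bounded derivatives by Cauchy's
  inequality.
\<close>

subsection \<open>Bounded operators\<close>

lemma bounded_opD:
  assumes "bounded_op B nrm T"
  shows bounded_op_mem: "g \<in> B \<Longrightarrow> T g \<in> B"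
    and bounded_op_add: "g \<in> B \<Longrightarrow> h \<in> B \<Longrightarrow> T (\<lambda>x. g x + h x) = (\<lambda>x. T g x + T h x)"
    and bounded_op_scale: "g \<in> B \<Longrightarrow> T (\<lambda>x. c * g x) = (\<lambda>x. c * T g x)"
  using assms by (auto simp: bounded_op_def)

context function_banach_space
begin

lemma diff_mem: "g \<in> B \<Longrightarrow> h \<in> B \<Longrightarrow> (\<lambda>x. g x - h x) \<in> B"
  using add_mem[of g "\<lambda>x. (-1) * h x"] scale_mem[of h "-1"] by simp

lemma sum_mem: "(\<And>i. i \<in> I \<Longrightarrow> g i \<in> B) \<Longrightarrow> (\<lambda>x. \<Sum>i\<in>I. g i x) \<in> B"
  by (induction I rule: infinite_finite_induct) (auto simp: zero_mem add_mem)

lemma nrm_zero [simp]: "nrm (\<lambda>x. 0) = 0"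
  using nrm_eq_0[OF zero_mem] by simp

lemma nrm_sum: "(\<And>i. i \<in> I \<Longrightarrow> g i \<in> B) \<Longrightarrow> nrm (\<lambda>x. \<Sum>i\<in>I. g i x) \<le> (\<Sum>i\<in>I. nrm (g i))"
proof (induction I rule: infinite_finite_induct)
  case (insert i I)
  then show ?case
    using nrm_triangle[of "g i" "\<lambda>x. \<Sum>i\<in>I. g i x"] sum_mem[of I g] by auto
qed auto

lemma nrm_commute: "g \<in> B \<Longrightarrow> h \<in> B \<Longrightarrow> nrm (\<lambda>x. g x - h x) = nrm (\<lambda>x. h x - g x)"
  using nrm_scale[OF diff_mem[of g h], of "-1"] by simp

lemma nrm_diff_triangle:
  "g \<in> B \<Longrightarrow> h \<in> B \<Longrightarrow> k \<in> B \<Longrightarrow>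
    nrm (\<lambda>x. g x - k x) \<le> nrm (\<lambda>x. g x - h x) + nrm (\<lambda>x. h x - k x)"
  using nrm_triangle[OF diff_mem[of g h] diff_mem[of h k]] by simp

lemma nrm_diff_le: "g \<in> B \<Longrightarrow> h \<in> B \<Longrightarrow> nrm (\<lambda>x. g x - h x) \<le> nrm g + nrm h"
  using nrm_diff_triangle[of g "\<lambda>x. 0" h] nrm_commute[of "\<lambda>x. 0" h] zero_mem by simp

lemma nrm_le_diff: "g \<in> B \<Longrightarrow> h \<in> B \<Longrightarrow> nrm g \<le> nrm (\<lambda>x. g x - h x) + nrm h"
  using nrm_triangle[OF diff_mem[of g h], of h] by simp

lemma eq_if_nrm_diff_0: "g \<in> B \<Longrightarrow> h \<in> B \<Longrightarrow> nrm (\<lambda>x. g x - h x) \<le> 0 \<Longrightarrow> g = h"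
  using nrm_eq_0[OF diff_mem[of g h]] nrm_nonneg[OF diff_mem[of g h]] by (auto simp: fun_eq_iff)

text \<open>Summing the geometric increments bounds every later difference by
  \<open>c * q ^ n / (1 - q)\<close>, so the sequence is Cauchy. This replaces the Banach fixed
  point theorem when \<open>l * u - T u = g\<close> is solved below.\<close>

lemma complete_geometric:
  assumes mem: "\<And>n. s n \<in> B" and q: "0 \<le> q" "q < 1"
    and step: "\<And>n. nrm (\<lambda>x. s (Suc n) x - s n x) \<le> c * q ^ n"
  shows "\<exists>g\<in>B. (\<lambda>n. nrm (\<lambda>x. s n x - g x)) \<longlonglongrightarrow> 0"
proof (rule complete[OF mem])
  fix e :: real assume "e > 0"
  have c: "c \<ge> 0"
    using step[of 0] nrm_nonneg[OF diff_mem[OF mem mem], of 1 0] by simp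
  have tail: "nrm (\<lambda>x. s (n + k) x - s n x) \<le> c * q ^ n / (1 - q)" for n k
  proof -
    have "nrm (\<lambda>x. s (n + k) x - s n x) \<le> c * q ^ n * (\<Sum>i<k. q ^ i)"
    proof (induction k)
      case (Suc k)
      show ?case
        using nrm_diff_triangle[OF mem mem mem, of "n + Suc k" n "n + k"] step[of "n + k"] Suc
        by (simp add: power_add algebra_simps)
    qed simp
    also have "\<dots> \<le> c * q ^ n * (1 / (1 - q))"
      using q c by (intro mult_left_mono) (auto simp: sum_gp_strict divide_right_mono)
    finally show ?thesis by simp
  qed
  have "(\<lambda>n. c * q ^ n / (1 - q)) \<longlonglongrightarrow> c * 0 / (1 - q)"
    using q by (intro tendsto_intros LIMSEQ_realpow_zero) auto
  then obtain K where K: "c * q ^ K / (1 - q) < e / 2"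
    using order_tendstoD(2)[of _ _ _ "e / 2"] \<open>e > 0\<close> by (force simp: eventually_sequentially)
  have "nrm (\<lambda>x. s m x - s n x) < e" if "m \<ge> K" "n \<ge> K" for m n
    using nrm_diff_triangle[OF mem mem mem, of m n K] nrm_commute[OF mem mem, of n K]
      tail[of K "m - K", unfolded le_add_diff_inverse[OF that(1)]]
      tail[of K "n - K", unfolded le_add_diff_inverse[OF that(2)]] K by linarith
  then show "\<exists>K. \<forall>m\<ge>K. \<forall>n\<ge>K. nrm (\<lambda>x. s m x - s n x) < e"
    by blast
qed

lemma bounded_op_zero: "bounded_op B nrm T \<Longrightarrow> T (\<lambda>x. 0) = (\<lambda>x. 0)"
  using bounded_op_scale[OF _ zero_mem, of nrm T 0] by simp

lemma bounded_op_diff: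
  assumes "bounded_op B nrm T" "g \<in> B" "h \<in> B"
  shows "T (\<lambda>x. g x - h x) = (\<lambda>x. T g x - T h x)"
  using bounded_op_add[OF assms(1,2) scale_mem[OF assms(3), of "-1"]]
    bounded_op_scale[OF assms(1,3), of "-1"] by simp

lemma bounded_op_sum:
  assumes "bounded_op B nrm T" "\<And>i. i \<in> I \<Longrightarrow> g i \<in> B"
  shows "T (\<lambda>x. \<Sum>i\<in>I. c i * g i x) = (\<lambda>x. \<Sum>i\<in>I. c i * T (g i) x)"
  using assms(2)
proof (induction I rule: infinite_finite_induct)
  case (insert i I)
  then have "T (\<lambda>x. c i * g i x + (\<Sum>i\<in>I. c i * g i x))
      = (\<lambda>x. T (\<lambda>x. c i * g i x) x + T (\<lambda>x. \<Sum>i\<in>I. c i * g i x) x)"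
    by (intro bounded_op_add[OF assms(1)] scale_mem sum_mem) auto
  with insert show ?case
    by (simp add: bounded_op_scale[OF assms(1)])
qed (auto simp: bounded_op_zero[OF assms(1)])

lemma bounded_op_bound:
  assumes "bounded_op B nrm T"
  obtains K where "K > 0" "\<And>g. g \<in> B \<Longrightarrow> nrm (T g) \<le> K * nrm g"
proof -
  obtain K where K: "\<And>g. g \<in> B \<Longrightarrow> nrm (T g) \<le> K * nrm g"
    using assms unfolding bounded_op_def by blast
  have "nrm (T g) \<le> (\<bar>K\<bar> + 1) * nrm g" if "g \<in> B" for g
    by (rule order_trans[OF K[OF that] mult_right_mono[OF _ nrm_nonneg[OF that]]]) auto
  then show ?thesis
    by (intro that[of "\<bar>K\<bar> + 1"]) auto
qed

lemma bounded_opI: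
  assumes "\<And>g. g \<in> B \<Longrightarrow> T g \<in> B"
    and "\<And>g h. g \<in> B \<Longrightarrow> h \<in> B \<Longrightarrow> T (\<lambda>x. g x + h x) = (\<lambda>x. T g x + T h x)"
    and "\<And>c g. g \<in> B \<Longrightarrow> T (\<lambda>x. c * g x) = (\<lambda>x. c * T g x)"
    and "\<And>g. g \<in> B \<Longrightarrow> nrm (T g) \<le> K * nrm g"
  shows "bounded_op B nrm T"
  using assms unfolding bounded_op_def by blast

lemma funpow_bound:
  assumes "\<And>g. g \<in> B \<Longrightarrow> T g \<in> B" "\<And>g. g \<in> B \<Longrightarrow> nrm (T g) \<le> K * nrm g" "0 \<le> K" "g \<in> B"
  shows "nrm ((T ^^ n) g) \<le> K ^ n * nrm g"
proof -
  have "(T ^^ n) g \<in> B \<and> nrm ((T ^^ n) g) \<le> K ^ n * nrm g"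
  proof (induction n)
    case (Suc n)
    have "nrm (T ((T ^^ n) g)) \<le> K * nrm ((T ^^ n) g)"
      using assms(2) Suc by blast
    also have "\<dots> \<le> K * (K ^ n * nrm g)"
      using Suc assms(3) by (intro mult_left_mono) auto
    finally show ?case
      using Suc assms(1) by (simp add: mult.assoc)
  qed (simp add: assms)
  then show ?thesis ..
qed

lemma bounded_op_funpow:
  assumes "bounded_op B nrm T"
  shows "bounded_op B nrm (T ^^ n)"
proof -
  obtain K where K: "K > 0" "\<And>g. g \<in> B \<Longrightarrow> nrm (T g) \<le> K * nrm g"
    using bounded_op_bound[OF assms] by blast
  have mem: "(T ^^ n) g \<in> B" if "g \<in> B" for g n
    using that by (induction n) (auto intro: bounded_op_mem[OF assms])
  show ?thesis
  proof (rule bounded_opI)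
    fix g assume g: "g \<in> B"
    show "(T ^^ n) g \<in> B"
      by (rule mem[OF g])
    show "nrm ((T ^^ n) g) \<le> K ^ n * nrm g"
      using K g bounded_op_mem[OF assms] by (intro funpow_bound) auto
    show "(T ^^ n) (\<lambda>x. c * g x) = (\<lambda>x. c * (T ^^ n) g x)" for c
      by (induction n) (auto simp: bounded_op_scale[OF assms mem[OF g]])
    show "(T ^^ n) (\<lambda>x. g x + h x) = (\<lambda>x. (T ^^ n) g x + (T ^^ n) h x)" if "h \<in> B" for h
      by (induction n) (auto simp: bounded_op_add[OF assms mem[OF g] mem[OF that]])
  qed
qed

lemma bounded_op_lincomb:
  assumes S: "bounded_op B nrm S" and T: "bounded_op B nrm T"
  shows "bounded_op B nrm (\<lambda>g x. a * S g x + b * T g x)"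
proof -
  obtain K where K: "\<And>g. g \<in> B \<Longrightarrow> nrm (S g) \<le> K * nrm g"
    using bounded_op_bound[OF S] by blast
  obtain K' where K': "\<And>g. g \<in> B \<Longrightarrow> nrm (T g) \<le> K' * nrm g"
    using bounded_op_bound[OF T] by blast
  show ?thesis
  proof (rule bounded_opI)
    fix g assume g: "g \<in> B"
    note mem = bounded_op_mem[OF S g] bounded_op_mem[OF T g]
    show "(\<lambda>x. a * S g x + b * T g x) \<in> B"
      using mem by (intro add_mem scale_mem)
    have "nrm (\<lambda>x. a * S g x + b * T g x) \<le> cmod a * nrm (S g) + cmod b * nrm (T g)"
      using nrm_triangle[OF scale_mem[OF mem(1), of a] scale_mem[OF mem(2), of b]]
      by (simp add: nrm_scale mem)
    also have "\<dots> \<le> cmod a * (K * nrm g) + cmod b * (K' * nrm g)"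
      using K[OF g] K'[OF g] by (intro add_mono mult_left_mono) auto
    finally show "nrm (\<lambda>x. a * S g x + b * T g x) \<le> (cmod a * K + cmod b * K') * nrm g"
      by (simp add: algebra_simps)
  qed (auto simp: bounded_op_add[OF S] bounded_op_add[OF T] bounded_op_scale[OF S]
      bounded_op_scale[OF T] algebra_simps)
qed

text \<open>Rescaling \<open>g\<close> to norm one reduces this to the definition of the supremum.
  Boundedness of \<open>T\<close> makes the set bounded above; otherwise its real \<open>Sup\<close>
  would carry no information.\<close>

lemma op_norm_bound:
  assumes T: "bounded_op B nrm T" and g: "g \<in> B"
  shows "nrm (T g) \<le> op_norm B nrm T * nrm g"
proof (cases "nrm g = 0")
  case True
  then show ?thesis
    using nrm_eq_0[OF g] bounded_op_zero[OF T] by simp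
next
  case False
  then have pos: "nrm g > 0"
    using nrm_nonneg[OF g] by simp
  define c where "c = complex_of_real (1 / nrm g)"
  have c: "cmod c = 1 / nrm g"
    using pos by (simp add: c_def norm_divide)
  obtain K where K: "K > 0" "\<And>g. g \<in> B \<Longrightarrow> nrm (T g) \<le> K * nrm g"
    using bounded_op_bound[OF T] by blast
  have "nrm (T h) \<le> K" if "h \<in> B" "nrm h \<le> 1" for h
    using K(2)[OF that(1)] mult_left_mono[OF that(2), of K] K(1) by linarith
  then have bdd: "bdd_above {nrm (T h) | h. h \<in> B \<and> nrm h \<le> 1}"
    by (auto intro!: bdd_aboveI)
  have "nrm (T (\<lambda>x. c * g x)) \<le> op_norm B nrm T"
    unfolding op_norm_def using pos c
    by (intro cSup_upper bdd) (auto intro!: exI[of _ "\<lambda>x. c * g x"] simp: scale_mem g nrm_scale)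
  then show ?thesis
    using pos c by (simp add: bounded_op_scale[OF T g] nrm_scale bounded_op_mem[OF T g] field_simps)
qed

lemma op_norm_le:
  assumes "\<And>g. g \<in> B \<Longrightarrow> nrm (T g) \<le> M * nrm g" "0 \<le> M"
  shows "op_norm B nrm T \<le> M"
  unfolding op_norm_def
proof (rule cSup_least)
  show "{nrm (T g) |g. g \<in> B \<and> nrm g \<le> 1} \<noteq> {}"
    using zero_mem by (auto intro!: exI[of _ "\<lambda>x. 0"])
  fix y assume "y \<in> {nrm (T g) |g. g \<in> B \<and> nrm g \<le> 1}"
  then obtain g where g: "g \<in> B" "nrm g \<le> 1" "y = nrm (T g)"
    by auto
  then show "y \<le> M"
    using assms(1)[OF g(1)] mult_left_mono[OF g(2) assms(2)] by simp
qed

end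

subsection \<open>Spectral gap\<close>

text \<open>Exchanging \<open>l\<close> and \<open>m\<close> in the exponent makes the sum geometric
  with ratio \<open>z\<close>, an n-th root of unity that equals 1 exactly if \<open>n\<close>
  divides \<open>m\<close>.\<close>

lemma sum_roots_of_unity_power:
  fixes n m :: nat
  assumes "n \<ge> 1"
  shows "(\<Sum>l<n. exp (2 * of_real pi * \<i> * of_nat l / of_nat n) ^ m) = (if n dvd m then of_nat n else 0)"
proof -
  define z where "z = exp (2 * of_real pi * \<i> * of_nat m / of_nat n)"
  have "exp (2 * of_real pi * \<i> * of_nat l / of_nat n) ^ m = z ^ l" for l
    unfolding z_def exp_of_nat_mult[symmetric] by (simp add: mult_ac)
  moreover have "z = 1 \<longleftrightarrow> n dvd m"
    unfolding z_def by (rule complex_root_unity_eq_1[OF assms])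
  moreover have "z ^ n = 1"
    unfolding z_def using assms by (intro complex_root_unity) auto
  ultimately show ?thesis
    by (simp add: sum_gp_strict)
qed

context function_banach_space
begin

text \<open>
  For \<open>w = s \<omega>\<close> with \<open>\<omega>\<^sup>n = 1\<close> and \<open>Y\<^sub>w = (\<Sum>i<n. w\<^sup>i T\<^sup>i)\<close> one has
  \<open>(1 - w T) Y\<^sub>w = 1 - s\<^sup>n T\<^sup>n\<close>, which bounds \<open>Y\<^sub>w\<^sup>2\<close>; averaging \<open>\<omega> Y\<^sub>w\<^sup>2\<close> over all \<open>\<omega>\<close>
  isolates the coefficient \<open>n s\<^bsup>n-1\<^esup> T\<^bsup>n-1\<^esup>\<close>.
\<close>

lemma nrm_funpow_if_bounded_below:
  assumes T: "bounded_op B nrm T" and c: "c > 0"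
    and below: "\<And>w v. cmod w \<le> 1 \<Longrightarrow> v \<in> B \<Longrightarrow> c * nrm v \<le> nrm (\<lambda>x. v x - w * T v x)"
    and s: "0 \<le> s" "s \<le> 1" and n: "n \<ge> 1"
    and \<kappa>: "\<And>v. v \<in> B \<Longrightarrow> nrm ((T ^^ n) v) \<le> \<kappa> * nrm v" "0 \<le> \<kappa>" and v: "v \<in> B"
  shows "real n * s ^ (n - 1) * nrm ((T ^^ (n - 1)) v) \<le> ((1 + s ^ n * \<kappa>) / c)\<^sup>2 * nrm v"
proof -
  define Y where "Y w v = (\<lambda>x. \<Sum>i<n. w ^ i * (T ^^ i) v x)" for w :: complex and v
  define M where "M = (1 + s ^ n * \<kappa>) / c"
  define \<omega> where "\<omega> l = exp (2 * of_real pi * \<i> * of_nat l / of_nat n)" for l :: nat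
  have Tm: "(T ^^ i) v \<in> B" if "v \<in> B" for i v
    by (rule bounded_op_mem[OF bounded_op_funpow[OF T] that])
  have Ym: "Y w v \<in> B" if "v \<in> B" for w v
    unfolding Y_def using that by (intro sum_mem scale_mem Tm)
  have tele: "(\<lambda>x. Y w v x - w * T (Y w v) x) = (\<lambda>x. v x - w ^ n * (T ^^ n) v x)" if "v \<in> B" for w v
  proof
    fix x
    have "T (Y w v) x = (\<Sum>i<n. w ^ i * (T ^^ Suc i) v x)"
      unfolding Y_def using bounded_op_sum[OF T, of "{..<n}" "\<lambda>i. (T ^^ i) v" "\<lambda>i. w ^ i"] Tm[OF that]
      by simp
    then have "Y w v x - w * T (Y w v) x
        = (\<Sum>i<n. w ^ i * (T ^^ i) v x - w ^ Suc i * (T ^^ Suc i) v x)"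
      by (simp add: Y_def sum_subtractf sum_distrib_left mult.assoc)
    also have "\<dots> = v x - w ^ n * (T ^^ n) v x"
      by (subst sum_lessThan_telescope') simp
    finally show "Y w v x - w * T (Y w v) x = v x - w ^ n * (T ^^ n) v x" .
  qed
  \<comment> \<open>Applying \<open>below\<close> to \<open>Y w v\<close> turns the telescoped
    identity into a norm bound without inverting 1 - w T.\<close>
  have Yb: "nrm (Y w v) \<le> M * nrm v" if "v \<in> B" "cmod w = s" for w v
  proof -
    have "c * nrm (Y w v) \<le> nrm (\<lambda>x. v x - w ^ n * (T ^^ n) v x)"
      using below[of w "Y w v"] Ym[OF that(1)] that s by (simp add: tele)
    also have "\<dots> \<le> nrm v + s ^ n * (\<kappa> * nrm v)"
      using nrm_diff_le[OF that(1) scale_mem[OF Tm[OF that(1)], of "w ^ n" n]]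
        mult_left_mono[OF \<kappa>(1)[OF that(1)], of "s ^ n"] s that
      by (simp add: nrm_scale Tm norm_power)
    finally show ?thesis
      using c by (simp add: M_def field_simps)
  qed
  have M: "M \<ge> 0"
    using c s \<kappa>(2) by (auto simp: M_def)
  have norm_\<omega>: "cmod (\<omega> l) = 1" for l
    by (simp add: \<omega>_def norm_exp_eq_Re)
  have YY: "Y w (Y w v) = (\<lambda>x. \<Sum>i<n. \<Sum>j<n. w ^ (i + j) * (T ^^ (i + j)) v x)" for w
  proof
    fix x
    have "(T ^^ i) (Y w v) x = (\<Sum>j<n. w ^ j * (T ^^ (i + j)) v x)" for i
      unfolding Y_def
      using bounded_op_sum[OF bounded_op_funpow[OF T], of "{..<n}" "\<lambda>i. (T ^^ i) v" i "\<lambda>i. w ^ i"] Tm[OF v]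
      by (simp add: funpow_add)
    then show "Y w (Y w v) x = (\<Sum>i<n. \<Sum>j<n. w ^ (i + j) * (T ^^ (i + j)) v x)"
      by (simp add: Y_def[of w "Y w v"] sum_distrib_left power_add mult_ac)
  qed
  \<comment> \<open>Squaring gains a factor \<open>n\<close>. The exponents \<open>i + j + 1\<close>
    lie between 1 and \<open>2 * n - 1\<close>, so divisibility by \<open>n\<close> selects the
    \<open>n\<close> pairs with \<open>i + j = n - 1\<close>, and each carries another
    \<open>n\<close> from the sum over \<open>l\<close>. A single \<open>Y\<close> would select just
    one index.\<close>
  have avg: "(\<lambda>x. \<Sum>l<n. \<omega> l * Y (s * \<omega> l) (Y (s * \<omega> l) v) x)
      = (\<lambda>x. of_nat n * of_nat n * of_real s ^ (n - 1) * (T ^^ (n - 1)) v x)"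
  proof
    fix x
    define a where "a i = of_real s ^ i * (T ^^ i) v x" for i
    have "(\<Sum>l<n. \<omega> l * Y (s * \<omega> l) (Y (s * \<omega> l) v) x)
        = (\<Sum>l<n. \<Sum>i<n. \<Sum>j<n. a (i + j) * \<omega> l ^ (i + j + 1))"
      unfolding YY a_def by (simp add: sum_distrib_left power_mult_distrib mult_ac)
    also have "\<dots> = (\<Sum>i<n. \<Sum>l<n. \<Sum>j<n. a (i + j) * \<omega> l ^ (i + j + 1))"
      by (rule sum.swap)
    also have "\<dots> = (\<Sum>i<n. \<Sum>j<n. \<Sum>l<n. a (i + j) * \<omega> l ^ (i + j + 1))"
      by (intro sum.cong refl sum.swap)
    also have "\<dots> = (\<Sum>i<n. \<Sum>j<n. a (i + j) * (if n dvd i + j + 1 then of_nat n else 0))"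
      unfolding \<omega>_def sum_distrib_left[symmetric] sum_roots_of_unity_power[OF n] ..
    also have "\<dots> = (\<Sum>i<n. \<Sum>j<n. if j = n - 1 - i then a (n - 1) * of_nat n else 0)"
    proof (intro sum.cong refl)
      fix i j assume ij: "i \<in> {..<n}" "j \<in> {..<n}"
      have "n dvd i + j + 1 \<longleftrightarrow> j = n - 1 - i"
      proof
        assume "n dvd i + j + 1"
        then obtain k where k: "i + j + 1 = n * k" ..
        have "n * k < n * 2"
          unfolding k[symmetric] using ij by auto
        moreover have "k > 0"
          using k by (cases k) auto
        ultimately have "k = 1"
          by simp
        with k ij show "j = n - 1 - i" by auto
      qed (use ij in auto)
      with ij show "a (i + j) * (if n dvd i + j + 1 then of_nat n else 0)
          = (if j = n - 1 - i then a (n - 1) * of_nat n else 0)"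
        by auto
    qed
    also have "\<dots> = of_nat n * of_nat n * of_real s ^ (n - 1) * (T ^^ (n - 1)) v x"
      using n by (simp add: a_def)
    finally show "(\<Sum>l<n. \<omega> l * Y (s * \<omega> l) (Y (s * \<omega> l) v) x)
      = of_nat n * of_nat n * of_real s ^ (n - 1) * (T ^^ (n - 1)) v x" .
  qed
  have "real n * (real n * s ^ (n - 1) * nrm ((T ^^ (n - 1)) v))
      = nrm (\<lambda>x. \<Sum>l<n. \<omega> l * Y (s * \<omega> l) (Y (s * \<omega> l) v) x)"
    unfolding avg using s by (simp add: nrm_scale Tm v norm_mult norm_power)
  also have "\<dots> \<le> (\<Sum>l<n. nrm (\<lambda>x. \<omega> l * Y (s * \<omega> l) (Y (s * \<omega> l) v) x))"
    by (intro nrm_sum scale_mem Ym v)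
  also have "\<dots> \<le> (\<Sum>l<n. M\<^sup>2 * nrm v)"
  proof (intro sum_mono)
    fix l
    have w: "cmod (s * \<omega> l) = s"
      using s by (simp add: norm_mult norm_\<omega>)
    have "nrm (Y (s * \<omega> l) (Y (s * \<omega> l) v)) \<le> M * (M * nrm v)"
      by (rule order_trans[OF Yb[OF Ym[OF v] w] mult_left_mono[OF Yb[OF v w] M]])
    then show "nrm (\<lambda>x. \<omega> l * Y (s * \<omega> l) (Y (s * \<omega> l) v) x) \<le> M\<^sup>2 * nrm v"
      by (simp add: nrm_scale Ym v norm_\<omega> power2_eq_square mult.assoc)
  qed
  also have "\<dots> = real n * (M\<^sup>2 * nrm v)"
    by simp
  finally show ?thesis
    using n by (simp add: M_def)
qed

text \<open>
  With \<open>\<kappa>\<close> the norm of \<open>T\<^sup>n\<close>, the previous bound reads \<open>n y \<le> D (1 + y)\<^sup>2\<close> for \<open>y = s\<^sup>n \<kappa>\<close>;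
  as \<open>y\<close> moves continuously from \<open>0\<close>, it cannot reach \<open>e\<close> once \<open>n e > D (1 + e)\<^sup>2\<close>.
\<close>

lemma funpow_small_if_bounded_below:
  assumes T: "bounded_op B nrm T" and c: "c > 0"
    and below: "\<And>w v. cmod w \<le> 1 \<Longrightarrow> v \<in> B \<Longrightarrow> c * nrm v \<le> nrm (\<lambda>x. v x - w * T v x)"
    and e: "0 < e"
  shows "\<exists>n\<ge>1. \<forall>v\<in>B. nrm ((T ^^ n) v) \<le> e * nrm v"
proof -
  obtain K where K: "K > 0" "\<And>g. g \<in> B \<Longrightarrow> nrm (T g) \<le> K * nrm g"
    using bounded_op_bound[OF T] by blast
  \<comment> \<open>The factor \<open>K\<close> pays for passing from \<open>T ^^ (n - 1)\<close>,
    which the averaging bound controls, to \<open>T ^^ n\<close>.\<close>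
  define D where "D = K * ((1 + e) / c)\<^sup>2"
  obtain n :: nat where n: "D / e < real n"
    using reals_Archimedean2 by blast
  have D: "D > 0"
    using K c e by (simp add: D_def)
  have n1: "n \<ge> 1"
    using n D e by (cases n) (auto simp: field_simps)
  define \<kappa> where "\<kappa> = op_norm B nrm (T ^^ n)"
  have \<kappa>: "nrm ((T ^^ n) v) \<le> \<kappa> * nrm v" if "v \<in> B" for v
    unfolding \<kappa>_def by (rule op_norm_bound[OF bounded_op_funpow[OF T] that])
  have "\<kappa> \<le> e"
  proof (rule ccontr)
    assume "\<not> \<kappa> \<le> e"
    then have pos: "\<kappa> > 0" "e / \<kappa> \<le> 1"
      using e by auto
    \<comment> \<open>Instead of moving \<open>s\<close> continuously, the value with
      \<open>s ^ n * \<kappa> = e\<close> is taken at once; it is at most 1 because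
      \<open>\<kappa>\<close> exceeds \<open>e\<close>.\<close>
    define s where "s = root n (e / \<kappa>)"
    have s: "0 < s" "s \<le> 1"
      using n1 pos e by (auto simp: s_def)
    have sn: "s ^ n = e / \<kappa>"
      using n1 pos e by (auto simp: s_def)
    have "nrm ((T ^^ n) v) \<le> D * \<kappa> / (real n * e) * nrm v" if v: "v \<in> B" for v
    proof -
      have Tv: "(T ^^ (n - 1)) v \<in> B"
        by (rule bounded_op_mem[OF bounded_op_funpow[OF T] v])
      have "(real n * s ^ n) * nrm ((T ^^ n) v) \<le> (real n * s ^ n) * (K * nrm ((T ^^ (n - 1)) v))"
        using K(2)[OF Tv] n1 s by (intro mult_left_mono) (cases n; simp)+
      also have "\<dots> = s * (K * (real n * s ^ (n - 1) * nrm ((T ^^ (n - 1)) v)))"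
        using n1 by (cases n) auto
      also have "\<dots> \<le> 1 * (K * (((1 + s ^ n * \<kappa>) / c)\<^sup>2 * nrm v))"
      proof (rule mult_mono[OF s(2) mult_left_mono])
        show "real n * s ^ (n - 1) * nrm ((T ^^ (n - 1)) v) \<le> ((1 + s ^ n * \<kappa>) / c)\<^sup>2 * nrm v"
          using s pos by (intro nrm_funpow_if_bounded_below[OF T c below _ _ n1 \<kappa> _ v]) auto
      qed (use K s nrm_nonneg[OF Tv] in auto)
      also have "\<dots> = D * nrm v"
        using pos by (simp add: D_def sn)
      finally have "(real n * (e / \<kappa>)) * nrm ((T ^^ n) v) \<le> D * nrm v"
        by (simp only: sn)
      then show ?thesis
        using pos e n1 by (simp add: field_simps)
    qed
    then have "\<kappa> \<le> D * \<kappa> / (real n * e)"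
      unfolding \<kappa>_def using D pos e by (intro op_norm_le) (auto simp: \<kappa>_def)
    then have "real n * e \<le> D"
      using pos e n1 by (simp add: field_simps)
    with n e show False
      by (simp add: field_simps)
  qed
  then have "nrm ((T ^^ n) v) \<le> e * nrm v" if "v \<in> B" for v
    using order_trans[OF \<kappa>[OF that] mult_right_mono[OF _ nrm_nonneg[OF that]]] by blast
  with n1 show ?thesis by blast
qed

section \<open>Spectrum, spectral radius and approximate eigenvectors\<close>

lemma eigenvalue_in_op_spectrum:
  assumes T: "bounded_op B nrm T" and g: "eigenfunction B T l g"
  shows "l \<in> op_spectrum B nrm T"
proof (rule ccontr)
  assume "l \<notin> op_spectrum B nrm T"
  then obtain R where R: "bounded_op B nrm R" "\<And>g. g \<in> B \<Longrightarrow> R (\<lambda>x. l * g x - T g x) = g"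
    by (auto simp: op_spectrum_def)
  have "g = (\<lambda>x. 0)"
    using R(2)[of g] g bounded_op_zero[OF R(1)] by (simp add: eigenfunction_def)
  with g show False
    by (simp add: eigenfunction_def)
qed

text \<open>The map \<open>D u = l * u - T u\<close> is bounded below by \<open>cmod l - K\<close>,
  hence injective with bounded inverse; surjectivity comes from a contraction. The lemma shows that
  the spectrum is a bounded set.\<close>

lemma not_in_op_spectrum_if_large:
  assumes T: "bounded_op B nrm T" and K: "\<And>g. g \<in> B \<Longrightarrow> nrm (T g) \<le> K * nrm g" "0 \<le> K"
    and l: "K < cmod l"
  shows "l \<notin> op_spectrum B nrm T"
proof -
  have l0: "l \<noteq> 0"
    using K l by auto
  note Tm = bounded_op_mem[OF T]
  define D where "D u = (\<lambda>x. l * u x - T u x)" for u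
  have Dm: "D u \<in> B" if "u \<in> B" for u
    unfolding D_def using that by (intro diff_mem scale_mem Tm)
  have Ddiff: "D (\<lambda>x. u x - v x) = (\<lambda>x. D u x - D v x)" if "u \<in> B" "v \<in> B" for u v
    unfolding D_def bounded_op_diff[OF T that] by (auto simp: algebra_simps)
  have Dbelow: "(cmod l - K) * nrm u \<le> nrm (D u)" if "u \<in> B" for u
    using nrm_le_diff[OF scale_mem[OF that, of l] Tm[OF that]] K(1)[OF that]
    by (simp add: nrm_scale that D_def algebra_simps)
  have inj: "u = v" if "u \<in> B" "v \<in> B" "D u = D v" for u v
  proof (rule eq_if_nrm_diff_0[OF that(1,2)])
    have "(cmod l - K) * nrm (\<lambda>x. u x - v x) \<le> 0"
      using Dbelow[OF diff_mem[OF that(1,2)]] that by (simp add: Ddiff)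
    then show "nrm (\<lambda>x. u x - v x) \<le> 0"
      using l by (simp add: mult_le_0_iff)
  qed
  have surj: "\<exists>u\<in>B. D u = g" if g: "g \<in> B" for g
  proof -
    \<comment> \<open>The solutions of \<open>D u = g\<close> are the fixed points of
      \<open>F\<close>, which contracts with ratio \<open>K / cmod l\<close>; the iterates from zero
      are the partial sums of the Neumann series.\<close>
    define F where "F u = (\<lambda>x. (1 / l) * (g x + T u x))" for u
    define s where "s n = (F ^^ n) (\<lambda>x. 0)" for n
    have Fm: "F u \<in> B" if "u \<in> B" for u
      unfolding F_def using that g by (intro scale_mem add_mem Tm)
    have sm: "s n \<in> B" for n
      by (induction n) (auto simp: s_def zero_mem Fm)
    have Flip: "nrm (\<lambda>x. F u x - F v x) \<le> (K / cmod l) * nrm (\<lambda>x. u x - v x)"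
      if uv: "u \<in> B" "v \<in> B" for u v
    proof -
      have "(\<lambda>x. F u x - F v x) = (\<lambda>x. (1 / l) * T (\<lambda>x. u x - v x) x)"
        unfolding bounded_op_diff[OF T uv] F_def by (auto simp: field_simps l0)
      then show ?thesis
        using K(1)[OF diff_mem[OF uv]] nrm_scale[OF Tm[OF diff_mem[OF uv]], of "1 / l"] l0
        by (simp add: norm_divide divide_right_mono)
    qed
    have q: "0 \<le> K / cmod l" "K / cmod l < 1"
      using K l by (auto simp: divide_less_eq)
    have step: "nrm (\<lambda>x. s (Suc n) x - s n x) \<le> nrm (\<lambda>x. s 1 x - s 0 x) * (K / cmod l) ^ n" for n
    proof (induction n)
      case (Suc n)
      have "nrm (\<lambda>x. s (Suc (Suc n)) x - s (Suc n) x) \<le> (K / cmod l) * nrm (\<lambda>x. s (Suc n) x - s n x)"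
        using Flip[OF sm sm, of "Suc n" n] by (simp add: s_def)
      also have "\<dots> \<le> (K / cmod l) * (nrm (\<lambda>x. s 1 x - s 0 x) * (K / cmod l) ^ n)"
        by (rule mult_left_mono[OF Suc q(1)])
      finally show ?case
        by (simp add: mult_ac)
    qed simp
    obtain u where u: "u \<in> B" "(\<lambda>n. nrm (\<lambda>x. s n x - u x)) \<longlonglongrightarrow> 0"
      using complete_geometric[OF sm q step] by blast
    have "F u = u"
    proof (rule eq_if_nrm_diff_0[OF Fm[OF u(1)] u(1)])
      have "nrm (\<lambda>x. F u x - u x) \<le> (K / cmod l) * nrm (\<lambda>x. s n x - u x) + nrm (\<lambda>x. s (Suc n) x - u x)" for n
        using nrm_diff_triangle[OF Fm[OF u(1)] Fm[OF sm] u(1), of n] Flip[OF u(1) sm, of n]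
          nrm_commute[OF u(1) sm, of n] by (simp add: s_def)
      moreover have "(\<lambda>n. (K / cmod l) * nrm (\<lambda>x. s n x - u x) + nrm (\<lambda>x. s (Suc n) x - u x))
          \<longlonglongrightarrow> (K / cmod l) * 0 + 0"
        by (intro tendsto_intros u(2) LIMSEQ_Suc)
      ultimately show "nrm (\<lambda>x. F u x - u x) \<le> 0"
        by (intro LIMSEQ_le_const[of _ 0]) auto
    qed
    then have "u x = (1 / l) * (g x + T u x)" for x
      unfolding F_def by metis
    then have "l * u x = l * ((1 / l) * (g x + T u x))" for x
      by metis
    then have "l * u x - T u x = g x" for x
      using l0 by simp
    with u(1) show ?thesis
      by (auto simp: D_def)
  qed
  \<comment> \<open>Injectivity makes the chosen preimage unique; comparing images under
    \<open>D\<close> then gives linearity of \<open>R\<close>.\<close>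
  define R where "R g = (SOME u. u \<in> B \<and> D u = g)" for g
  have R: "R g \<in> B" "D (R g) = g" if "g \<in> B" for g
    using someI_ex[of "\<lambda>u. u \<in> B \<and> D u = g"] surj[OF that] by (auto simp: R_def)
  have "bounded_op B nrm R"
  proof (rule bounded_opI[of _ "1 / (cmod l - K)"])
    fix g assume g: "g \<in> B"
    show "R g \<in> B" using R(1)[OF g] .
    show "nrm (R g) \<le> 1 / (cmod l - K) * nrm g"
      using Dbelow[OF R(1)[OF g]] l by (simp add: R(2)[OF g] field_simps)
    show "R (\<lambda>x. c * g x) = (\<lambda>x. c * R g x)" for c
    proof (rule inj)
      have "D (\<lambda>x. c * R g x) = (\<lambda>x. c * D (R g) x)"
        unfolding D_def by (auto simp: bounded_op_scale[OF T R(1)[OF g]] algebra_simps)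
      then show "D (R (\<lambda>x. c * g x)) = D (\<lambda>x. c * R g x)"
        by (simp add: R g scale_mem)
    qed (auto intro!: R(1) scale_mem g)
    show "R (\<lambda>x. g x + h x) = (\<lambda>x. R g x + R h x)" if h: "h \<in> B" for h
    proof (rule inj)
      have "D (\<lambda>x. R g x + R h x) = (\<lambda>x. D (R g) x + D (R h) x)"
        unfolding D_def by (auto simp: bounded_op_add[OF T R(1)[OF g] R(1)[OF h]] algebra_simps)
      then show "D (R (\<lambda>x. g x + h x)) = D (\<lambda>x. R g x + R h x)"
        by (simp add: R g h add_mem)
    qed (auto intro!: R(1) add_mem g h)
  qed
  moreover have "R (D g) = g" if "g \<in> B" for g
    by (rule inj[OF R(1)[OF Dm[OF that]] that R(2)[OF Dm[OF that]]])
  ultimately show ?thesis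
    using R(2) unfolding op_spectrum_def D_def by blast
qed

text \<open>The spectrum lies in a disc of radius \<open>K\<close>. This makes the real supremum in
  \<open>op_spectral_radius\<close> an upper bound of all its members.\<close>

lemma eigenvalue_le_op_spectral_radius:
  assumes T: "bounded_op B nrm T" and g: "eigenfunction B T l g"
  shows "cmod l \<le> op_spectral_radius B nrm T"
proof -
  obtain K where K: "K > 0" "\<And>g. g \<in> B \<Longrightarrow> nrm (T g) \<le> K * nrm g"
    using bounded_op_bound[OF T] by blast
  have "cmod w \<le> K" if "w \<in> op_spectrum B nrm T" for w
    using not_in_op_spectrum_if_large[OF T K(2), of w] K(1) that by force
  then have "bdd_above (cmod ` op_spectrum B nrm T)"
    by (auto intro!: bdd_aboveI)
  then show ?thesis
    unfolding op_spectral_radius_def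
    by (intro cSUP_upper eigenvalue_in_op_spectrum[OF T g])
qed

text \<open>
  Approximate eigenvectors \<open>v\<^sub>n\<close> for an eigenvalue \<open>1 / w\<close> with \<open>|w| \<le> 1\<close> satisfy
  \<open>(1 - w\<^sup>m R) v\<^sub>n - w\<^sup>m K v\<^sub>n \<longlonglongrightarrow> 0\<close>, and \<open>1 - w\<^sup>m R\<close> is bounded below because \<open>R\<close> is a
  contraction, so compactness of \<open>K\<close> makes a subsequence converge to a genuine eigenvector.
\<close>

lemma bounded_below_if_no_eigenvalue:
  assumes T: "bounded_op B nrm T" and K: "compact_op B nrm K" and R: "bounded_op B nrm R"
    and Rb: "\<And>g. g \<in> B \<Longrightarrow> nrm (R g) \<le> \<rho> * nrm g" and \<rho>: "\<rho> < 1"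
    and split: "\<And>g. g \<in> B \<Longrightarrow> (T ^^ m) g = (\<lambda>x. K g x + R g x)"
    and E: "E \<subseteq> B" "\<And>g c. g \<in> E \<Longrightarrow> (\<lambda>x. c * g x) \<in> E"
      "\<And>s g. (\<And>n. s n \<in> E) \<Longrightarrow> g \<in> B \<Longrightarrow> (\<lambda>n. nrm (\<lambda>x. s n x - g x)) \<longlonglongrightarrow> 0 \<Longrightarrow> g \<in> E"
    and no_eigen: "\<And>l g. g \<in> E \<Longrightarrow> 1 \<le> cmod l \<Longrightarrow> T g = (\<lambda>x. l * g x) \<Longrightarrow> g = (\<lambda>x. 0)"
  shows "\<exists>c>0. \<forall>w v. cmod w \<le> 1 \<longrightarrow> v \<in> E \<longrightarrow> c * nrm v \<le> nrm (\<lambda>x. v x - w * T v x)"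
proof (rule ccontr)
  assume neg: "\<not> ?thesis"
  note Tm = bounded_op_mem[OF T]
  \<comment> \<open>The negated claim is used with the constant \<open>1 / real (Suc n)\<close>, and
    the vector is rescaled to norm one inside \<open>E\<close>.\<close>
  have "\<exists>w v. cmod w \<le> 1 \<and> v \<in> E \<and> nrm v = 1 \<and> nrm (\<lambda>x. v x - w * T v x) < 1 / real (Suc n)" for n
  proof -
    have "1 / real (Suc n) > 0" by simp
    with neg obtain w v where wv: "cmod w \<le> 1" "v \<in> E"
        "nrm (\<lambda>x. v x - w * T v x) < 1 / real (Suc n) * nrm v"
      by (meson not_le)
    have vB: "v \<in> B" using wv E(1) by auto
    have D: "(\<lambda>x. v x - w * T v x) \<in> B"
      by (intro diff_mem scale_mem Tm vB)
    have pos: "nrm v > 0"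
      using wv(3) nrm_nonneg[OF D] nrm_nonneg[OF vB] by (cases "nrm v = 0") auto
    define u where "u = (\<lambda>x. complex_of_real (1 / nrm v) * v x)"
    have "(\<lambda>x. u x - w * T u x) = (\<lambda>x. complex_of_real (1 / nrm v) * (v x - w * T v x))"
      unfolding u_def bounded_op_scale[OF T vB] by (auto simp: algebra_simps)
    then have "nrm (\<lambda>x. u x - w * T u x) = nrm (\<lambda>x. v x - w * T v x) / nrm v"
      using pos by (simp only: nrm_scale[OF D]) (simp add: norm_divide)
    then have "nrm (\<lambda>x. u x - w * T u x) < 1 / real (Suc n)"
      using wv(3) pos by (simp add: divide_less_eq)
    moreover have "nrm u = 1"
      using pos unfolding u_def nrm_scale[OF vB] by (simp add: norm_divide)
    ultimately show ?thesis
      using wv E(2)[OF wv(2), of "complex_of_real (1 / nrm v)"] by (auto simp: u_def)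
  qed
  then obtain w0 v0 where wv0: "\<And>n. cmod (w0 n) \<le> 1" "\<And>n. v0 n \<in> E" "\<And>n. nrm (v0 n) = 1"
      "\<And>n. nrm (\<lambda>x. v0 n x - w0 n * T (v0 n) x) < 1 / real (Suc n)"
    by metis
  \<comment> \<open>Two extractions: \<open>r1\<close> makes the parameters converge in the closed
    unit disc, \<open>r2\<close> makes the images under \<open>K\<close> converge.\<close>
  have "compact (cball (0::complex) 1)" "\<And>n. w0 n \<in> cball 0 1"
    using wv0(1) by auto
  then obtain z r1 where z: "z \<in> cball 0 1" "strict_mono (r1 :: nat \<Rightarrow> nat)" "(w0 \<circ> r1) \<longlonglongrightarrow> z"
    unfolding compact_def by metis
  have "\<forall>n. (v0 \<circ> r1) n \<in> B \<and> nrm ((v0 \<circ> r1) n) \<le> 1"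
    using wv0 E(1) by auto
  then obtain g r2 where g: "g \<in> B" "strict_mono (r2 :: nat \<Rightarrow> nat)"
      "(\<lambda>n. nrm (\<lambda>x. K ((v0 \<circ> r1) (r2 n)) x - g x)) \<longlonglongrightarrow> 0"
    using K unfolding compact_op_def by metis
  define r where "r = r1 \<circ> r2"
  have r: "strict_mono r"
    unfolding r_def by (rule strict_mono_o[OF z(2) g(2)])
  define w where "w = w0 \<circ> r"
  define v where "v = v0 \<circ> r"
  have w_lim: "w \<longlonglongrightarrow> z"
    using LIMSEQ_subseq_LIMSEQ[OF z(3) g(2)] by (simp add: w_def r_def o_assoc)
  have vE: "v n \<in> E" and v1: "nrm (v n) = 1" and vB: "v n \<in> B" for n
    using wv0 E(1) by (auto simp: v_def)
  have K_lim: "(\<lambda>n. nrm (\<lambda>x. K (v n) x - g x)) \<longlonglongrightarrow> 0"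
    using g(3) by (simp add: v_def r_def)
  have res_lim: "(\<lambda>n. nrm (\<lambda>x. v n x - w n * T (v n) x)) \<longlonglongrightarrow> 0"
  proof (rule Lim_null_comparison)
    have "nrm (\<lambda>x. v n x - w n * T (v n) x) \<le> 1 / real (Suc n)" for n
    proof -
      have "nrm (\<lambda>x. v n x - w n * T (v n) x) < 1 / real (Suc (r n))"
        using wv0(4)[of "r n"] by (simp add: v_def w_def)
      also have "\<dots> \<le> 1 / real (Suc n)"
        using seq_suble[OF r, of n] by (intro divide_left_mono) auto
      finally show ?thesis by simp
    qed
    then show "\<forall>\<^sub>F n in sequentially. norm (nrm (\<lambda>x. v n x - w n * T (v n) x)) \<le> 1 / real (Suc n)"
      by (intro always_eventually) (auto simp: abs_of_nonneg nrm_nonneg diff_mem scale_mem Tm vB)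
    show "(\<lambda>n. 1 / real (Suc n)) \<longlonglongrightarrow> 0"
      using LIMSEQ_inverse_real_of_nat by (simp add: inverse_eq_divide)
  qed
  obtain k where k: "k > 0" "\<And>g. g \<in> B \<Longrightarrow> nrm (T g) \<le> k * nrm g"
    using bounded_op_bound[OF T] by blast
  have z1: "cmod z \<le> 1" using z(1) by simp
  have lim_le: "f \<longlonglongrightarrow> 0" if "\<And>n. 0 \<le> f n" "\<And>n. f n \<le> h n" "h \<longlonglongrightarrow> 0" for f h :: "nat \<Rightarrow> real"
    by (rule tendsto_sandwich[OF _ _ tendsto_const that(3)]) (auto intro: that always_eventually)
  have z_lim: "(\<lambda>n. nrm (\<lambda>x. v n x - z * T (v n) x)) \<longlonglongrightarrow> 0"
  proof (rule lim_le)
    fix n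
    show "0 \<le> nrm (\<lambda>x. v n x - z * T (v n) x)"
      by (intro nrm_nonneg diff_mem scale_mem Tm vB)
    have "nrm (\<lambda>x. w n * T (v n) x - z * T (v n) x) = cmod (w n - z) * nrm (T (v n))"
      using nrm_scale[OF Tm[OF vB], of "w n - z" n] by (simp add: left_diff_distrib)
    also have "\<dots> \<le> cmod (w n - z) * k"
      using k(2)[OF vB, of n] by (intro mult_left_mono) (auto simp: v1)
    finally show "nrm (\<lambda>x. v n x - z * T (v n) x)
        \<le> nrm (\<lambda>x. v n x - w n * T (v n) x) + cmod (w n - z) * k"
      using nrm_diff_triangle[OF vB scale_mem[OF Tm[OF vB]] scale_mem[OF Tm[OF vB]], of n z n "w n" n]
      by simp
  next
    have "(\<lambda>n. nrm (\<lambda>x. v n x - w n * T (v n) x) + cmod (w n - z) * k) \<longlonglongrightarrow> 0 + cmod (z - z) * k"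
      by (intro tendsto_intros res_lim w_lim)
    then show "(\<lambda>n. nrm (\<lambda>x. v n x - w n * T (v n) x) + cmod (w n - z) * k) \<longlonglongrightarrow> 0"
      by simp
  qed
  have Tj: "(T ^^ j) (v n) \<in> B" for j n
    by (rule bounded_op_mem[OF bounded_op_funpow[OF T] vB])
  \<comment> \<open>One more power arises by applying \<open>z * T\<close> to the error
    \<open>d\<close> of the power \<open>j\<close>, which enlarges it at most by the factor
    \<open>k\<close> because \<open>cmod z\<close> is at most 1.\<close>
  have pow_lim: "(\<lambda>n. nrm (\<lambda>x. v n x - z ^ j * (T ^^ j) (v n) x)) \<longlonglongrightarrow> 0" for j
  proof (induction j)
    case (Suc j)
    show ?case
    proof (rule lim_le)
      fix n
      show "0 \<le> nrm (\<lambda>x. v n x - z ^ Suc j * (T ^^ Suc j) (v n) x)"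
        by (intro nrm_nonneg diff_mem scale_mem Tj vB)
      define d where "d = (\<lambda>x. v n x - z ^ j * (T ^^ j) (v n) x)"
      have d: "d \<in> B"
        unfolding d_def by (intro diff_mem scale_mem Tj vB)
      have "T d = (\<lambda>x. T (v n) x - z ^ j * (T ^^ Suc j) (v n) x)"
        unfolding d_def bounded_op_diff[OF T vB scale_mem[OF Tj]] bounded_op_scale[OF T Tj] by simp
      then have eq: "(\<lambda>x. v n x - z ^ Suc j * (T ^^ Suc j) (v n) x)
          = (\<lambda>x. (v n x - z * T (v n) x) + z * T d x)"
        by (auto simp: algebra_simps)
      have "nrm (\<lambda>x. z * T d x) \<le> 1 * (k * nrm d)"
        using k(2)[OF d] z1 nrm_nonneg[OF Tm[OF d]]
        unfolding nrm_scale[OF Tm[OF d]] by (intro mult_mono) auto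
      moreover have "nrm (\<lambda>x. v n x - z ^ Suc j * (T ^^ Suc j) (v n) x)
          \<le> nrm (\<lambda>x. v n x - z * T (v n) x) + nrm (\<lambda>x. z * T d x)"
        unfolding eq by (intro nrm_triangle diff_mem scale_mem Tm vB d)
      ultimately show "nrm (\<lambda>x. v n x - z ^ Suc j * (T ^^ Suc j) (v n) x)
          \<le> nrm (\<lambda>x. v n x - z * T (v n) x) + k * nrm (\<lambda>x. v n x - z ^ j * (T ^^ j) (v n) x)"
        by (simp add: d_def)
    next
      have "(\<lambda>n. nrm (\<lambda>x. v n x - z * T (v n) x) + k * nrm (\<lambda>x. v n x - z ^ j * (T ^^ j) (v n) x))
          \<longlonglongrightarrow> 0 + k * 0"
        by (intro tendsto_intros z_lim Suc)
      then show "(\<lambda>n. nrm (\<lambda>x. v n x - z * T (v n) x) + k * nrm (\<lambda>x. v n x - z ^ j * (T ^^ j) (v n) x))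
          \<longlonglongrightarrow> 0"
        by simp
    qed
  qed simp
  have Kop: "bounded_op B nrm K"
    using K by (simp add: compact_op_def)
  \<comment> \<open>As \<open>T ^^ m\<close> is the sum of \<open>K\<close> and \<open>R\<close>,
    \<open>y n\<close> is asymptotically \<open>z ^ m * K (v n)\<close>, which tends to
    \<open>z ^ m * g\<close>; \<open>e n\<close> is the distance to that limit.\<close>
  define y where "y n = (\<lambda>x. v n x - z ^ m * R (v n) x)" for n
  define e where "e n = nrm (\<lambda>x. y n x - z ^ m * g x)" for n
  have yB: "y n \<in> B" for n
    unfolding y_def by (intro diff_mem scale_mem bounded_op_mem[OF R] vB)
  have zgB: "(\<lambda>x. z ^ m * g x) \<in> B"
    by (intro scale_mem g)
  have e_lim: "e \<longlonglongrightarrow> 0"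
  proof (rule lim_le)
    fix n
    show "0 \<le> e n"
      unfolding e_def by (intro nrm_nonneg diff_mem yB zgB)
    have Kg: "(\<lambda>x. K (v n) x - g x) \<in> B"
      by (intro diff_mem bounded_op_mem[OF Kop] vB g)
    have eq: "(\<lambda>x. y n x - z ^ m * g x)
        = (\<lambda>x. (v n x - z ^ m * (T ^^ m) (v n) x) + z ^ m * (K (v n) x - g x))"
      by (auto simp: y_def split[OF vB] algebra_simps)
    have "e n \<le> nrm (\<lambda>x. v n x - z ^ m * (T ^^ m) (v n) x) + nrm (\<lambda>x. z ^ m * (K (v n) x - g x))"
      unfolding e_def eq by (intro nrm_triangle scale_mem Kg diff_mem Tj vB)
    moreover have "nrm (\<lambda>x. z ^ m * (K (v n) x - g x)) \<le> 1 * nrm (\<lambda>x. K (v n) x - g x)"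
      unfolding nrm_scale[OF Kg] using nrm_nonneg[OF Kg] z1
      by (intro mult_right_mono) (auto simp: norm_power power_le_one)
    ultimately show "e n \<le> nrm (\<lambda>x. v n x - z ^ m * (T ^^ m) (v n) x) + nrm (\<lambda>x. K (v n) x - g x)"
      by simp
  next
    show "(\<lambda>n. nrm (\<lambda>x. v n x - z ^ m * (T ^^ m) (v n) x) + nrm (\<lambda>x. K (v n) x - g x)) \<longlonglongrightarrow> 0"
      using tendsto_add[OF pow_lim K_lim] by simp
  qed
  \<comment> \<open>The operator 1 - z^m R is bounded below by \<open>1 - \<rho>\<close>, so
    convergence of \<open>y\<close> forces \<open>v\<close> to be Cauchy.\<close>
  have cauchy: "(1 - \<rho>) * nrm (\<lambda>x. v i x - v j x) \<le> e i + e j" for i j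
  proof -
    define d where "d = (\<lambda>x. v i x - v j x)"
    have d: "d \<in> B"
      unfolding d_def by (intro diff_mem vB)
    have Rd: "R d \<in> B" by (rule bounded_op_mem[OF R d])
    have eq: "(\<lambda>x. d x - z ^ m * R d x) = (\<lambda>x. y i x - y j x)"
      unfolding d_def bounded_op_diff[OF R vB vB] by (auto simp: y_def algebra_simps)
    have "nrm d \<le> nrm (\<lambda>x. d x - z ^ m * R d x) + nrm (\<lambda>x. z ^ m * R d x)"
      by (intro nrm_le_diff scale_mem d Rd)
    also have "nrm (\<lambda>x. z ^ m * R d x) \<le> 1 * nrm (R d)"
      unfolding nrm_scale[OF Rd] using nrm_nonneg[OF Rd] z1
      by (intro mult_right_mono) (auto simp: norm_power power_le_one)
    also have "\<dots> \<le> \<rho> * nrm d"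
      using Rb[OF d] by simp
    also have "nrm (\<lambda>x. d x - z ^ m * R d x) \<le> e i + e j"
      unfolding eq e_def using nrm_diff_triangle[OF yB zgB yB, of i j] nrm_commute[OF yB zgB, of j] by simp
    finally show ?thesis
      by (simp add: d_def algebra_simps)
  qed
  have "\<exists>u\<in>B. (\<lambda>n. nrm (\<lambda>x. v n x - u x)) \<longlonglongrightarrow> 0"
  proof (rule complete[OF vB])
    fix \<epsilon> :: real assume "\<epsilon> > 0"
    then have "(1 - \<rho>) * \<epsilon> / 2 > 0" using \<rho> by simp
    then obtain N where N: "\<And>n. n \<ge> N \<Longrightarrow> e n < (1 - \<rho>) * \<epsilon> / 2"
      using order_tendstoD(2)[OF e_lim, of "(1 - \<rho>) * \<epsilon> / 2"]
      unfolding eventually_sequentially by blast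
    have "nrm (\<lambda>x. v i x - v j x) < \<epsilon>" if "i \<ge> N" "j \<ge> N" for i j
    proof -
      have "(1 - \<rho>) * nrm (\<lambda>x. v i x - v j x) < (1 - \<rho>) * \<epsilon>"
        using cauchy[of i j] N[OF that(1)] N[OF that(2)] by linarith
      then show ?thesis
        using \<rho> by simp
    qed
    then show "\<exists>N. \<forall>i\<ge>N. \<forall>j\<ge>N. nrm (\<lambda>x. v i x - v j x) < \<epsilon>"
      by blast
  qed
  then obtain u where u: "u \<in> B" "(\<lambda>n. nrm (\<lambda>x. v n x - u x)) \<longlonglongrightarrow> 0"
    by blast
  have uE: "u \<in> E"
    by (rule E(3)[OF vE u])
  \<comment> \<open>The normalization survives the limit and keeps \<open>u\<close> from
    vanishing.\<close>
  have "1 \<le> nrm (\<lambda>x. v n x - u x) + nrm u" for n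
    using nrm_le_diff[OF vB u(1), of n] by (simp add: v1)
  moreover have "(\<lambda>n. nrm (\<lambda>x. v n x - u x) + nrm u) \<longlonglongrightarrow> 0 + nrm u"
    by (intro tendsto_intros u)
  ultimately have u0: "u \<noteq> (\<lambda>x. 0)"
    using LIMSEQ_le_const[of "\<lambda>n. nrm (\<lambda>x. v n x - u x) + nrm u" "0 + nrm u" 1] by auto
  have "nrm (\<lambda>x. u x - z * T u x) \<le> 0"
  proof (rule LIMSEQ_le_const)
    have "(\<lambda>n. nrm (\<lambda>x. v n x - u x) + nrm (\<lambda>x. v n x - z * T (v n) x) + k * nrm (\<lambda>x. v n x - u x))
        \<longlonglongrightarrow> 0 + 0 + k * 0"
      by (intro tendsto_intros u z_lim)
    then show "(\<lambda>n. nrm (\<lambda>x. v n x - u x) + nrm (\<lambda>x. v n x - z * T (v n) x) + k * nrm (\<lambda>x. v n x - u x))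
        \<longlonglongrightarrow> 0" by simp
    have "nrm (\<lambda>x. u x - z * T u x)
        \<le> nrm (\<lambda>x. v n x - u x) + nrm (\<lambda>x. v n x - z * T (v n) x) + k * nrm (\<lambda>x. v n x - u x)" for n
    proof -
      have d: "(\<lambda>x. v n x - u x) \<in> B"
        by (intro diff_mem vB u)
      have eq: "(\<lambda>x. z * T (v n) x - z * T u x) = (\<lambda>x. z * T (\<lambda>x. v n x - u x) x)"
        unfolding bounded_op_diff[OF T vB u(1)] by (simp add: right_diff_distrib)
      have "nrm (\<lambda>x. z * T (v n) x - z * T u x) = cmod z * nrm (T (\<lambda>x. v n x - u x))"
        unfolding eq by (rule nrm_scale[OF Tm[OF d]])
      also have "\<dots> \<le> 1 * (k * nrm (\<lambda>x. v n x - u x))"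
        using k(2)[OF d] z1 nrm_nonneg[OF Tm[OF d]] by (intro mult_mono) auto
      finally show ?thesis
        using nrm_diff_triangle[OF u(1) vB scale_mem[OF Tm[OF u(1)]], of z n]
          nrm_diff_triangle[OF vB scale_mem[OF Tm[OF vB]] scale_mem[OF Tm[OF u(1)]], of n z z n]
          nrm_commute[OF u(1) vB, of n]
        by simp
    qed
    then show "\<exists>N. \<forall>n\<ge>N. nrm (\<lambda>x. u x - z * T u x)
        \<le> nrm (\<lambda>x. v n x - u x) + nrm (\<lambda>x. v n x - z * T (v n) x) + k * nrm (\<lambda>x. v n x - u x)"
      by blast
  qed
  \<comment> \<open>A nonzero \<open>u\<close> with u = z T u forces \<open>z\<close> to be nonzero,
    and \<open>1 / z\<close> is then one of the excluded eigenvalues.\<close>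
  then have fixed: "u = (\<lambda>x. z * T u x)"
    by (intro eq_if_nrm_diff_0 u scale_mem Tm)
  with u0 have z0: "z \<noteq> 0"
    by auto
  have "T u = (\<lambda>x. (1 / z) * u x)"
    using fun_cong[OF fixed] z0 by (auto simp: field_simps)
  moreover have "1 \<le> cmod (1 / z)"
    using z0 z1 by (simp add: norm_divide)
  ultimately show False
    using no_eigen[OF uE] u0 by blast
qed

end

subsection \<open>Renewal sequences\<close>

text \<open>Weierstrass' theorem with a rate: the tail of the geometric series bounds the distance
  to the pointwise limit uniformly on \<open>W\<close>.\<close>

lemma holomorphic_geometric_limit:
  fixes F :: "nat \<Rightarrow> complex \<Rightarrow> complex"
  assumes W: "open W" and hol: "\<And>n. F n holomorphic_on W"
    and step: "\<And>n z. z \<in> W \<Longrightarrow> cmod (F (Suc n) z - F n z) \<le> C * \<theta> ^ n"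
    and \<theta>: "0 < \<theta>" "\<theta> < 1"
  obtains G where "G holomorphic_on W"
    "\<And>n z. z \<in> W \<Longrightarrow> cmod (F n z - G z) \<le> C * \<theta> ^ n / (1 - \<theta>)"
proof -
  \<comment> \<open>An empty \<open>W\<close> would admit a negative \<open>C\<close>, so the sign
    has to come from a point of \<open>W\<close>.\<close>
  have C: "C \<ge> 0" if "z \<in> W" for z
    using order_trans[OF norm_ge_zero step[OF that, of 0]] by simp
  have tail: "cmod (F (n + k) z - F n z) \<le> C * \<theta> ^ n / (1 - \<theta>)" if z: "z \<in> W" for n k z
  proof -
    have "cmod (F (n + k) z - F n z) \<le> C * \<theta> ^ n * (\<Sum>i<k. \<theta> ^ i)"
    proof (induction k)
      case (Suc k)
      have "cmod (F (n + Suc k) z - F n z)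
          \<le> cmod (F (Suc (n + k)) z - F (n + k) z) + cmod (F (n + k) z - F n z)"
        using norm_triangle_ineq[of "F (Suc (n + k)) z - F (n + k) z" "F (n + k) z - F n z"] by simp
      with Suc step[OF z, of "n + k"] show ?case
        by (simp add: power_add algebra_simps)
    qed simp
    also have "\<dots> \<le> C * \<theta> ^ n * (1 / (1 - \<theta>))"
      using \<theta> C[OF z] by (intro mult_left_mono) (auto simp: sum_gp_strict divide_right_mono)
    finally show ?thesis by simp
  qed
  have lim0: "(\<lambda>n. C * \<theta> ^ n / (1 - \<theta>)) \<longlonglongrightarrow> 0"
    using \<theta> tendsto_mult[OF tendsto_const[of "C / (1 - \<theta>)"] LIMSEQ_realpow_zero[of \<theta>]] by simp
  have "convergent (\<lambda>n. F n z)" if z: "z \<in> W" for z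
  proof (intro Cauchy_convergent metric_CauchyI)
    fix e :: real assume "e > 0"
    then obtain N where N: "\<And>n. n \<ge> N \<Longrightarrow> C * \<theta> ^ n / (1 - \<theta>) < e"
      using order_tendstoD(2)[OF lim0] by (auto simp: eventually_sequentially)
    have le: "dist (F m z) (F n z) < e" if "m \<ge> N" "n \<ge> m" for m n
      using tail[OF z, of m "n - m"] N[OF that(1)] that
      by (simp add: dist_norm norm_minus_commute)
    have "dist (F m z) (F n z) < e" if "m \<ge> N" "n \<ge> N" for m n
      using le[of m n] le[of n m] that by (cases "m \<le> n") (auto simp: dist_commute)
    then show "\<exists>M. \<forall>m\<ge>M. \<forall>n\<ge>M. dist (F m z) (F n z) < e"
      by blast
  qed
  then have lim: "(\<lambda>n. F n z) \<longlonglongrightarrow> lim (\<lambda>n. F n z)" if "z \<in> W" for z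
    using that by (simp add: convergent_LIMSEQ_iff)
  define G where "G z = lim (\<lambda>n. F n z)" for z
  have bound: "cmod (F n z - G z) \<le> C * \<theta> ^ n / (1 - \<theta>)" if z: "z \<in> W" for n z
  proof (rule LIMSEQ_le_const2)
    show "(\<lambda>k. cmod (F n z - F (k + n) z)) \<longlonglongrightarrow> cmod (F n z - G z)"
      unfolding G_def by (intro tendsto_intros LIMSEQ_ignore_initial_segment lim z)
    show "\<exists>N. \<forall>k\<ge>N. cmod (F n z - F (k + n) z) \<le> C * \<theta> ^ n / (1 - \<theta>)"
      using tail[OF z, of n] by (auto simp: norm_minus_commute add.commute)
  qed
  have unif: "uniform_limit W F G sequentially"
  proof (rule uniform_limitI)
    fix e :: real assume "e > 0"
    then have "\<forall>\<^sub>F n in sequentially. C * \<theta> ^ n / (1 - \<theta>) < e"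
      using order_tendstoD(2)[OF lim0] by blast
    then show "\<forall>\<^sub>F n in sequentially. \<forall>x\<in>W. dist (F n x) (G x) < e"
      by eventually_elim (auto simp: dist_norm intro: le_less_trans[OF bound])
  qed
  have "G holomorphic_on W"
  proof (rule holomorphic_uniform_sequence[OF W hol])
    fix x assume "x \<in> W"
    then obtain d where "d > 0" "cball x d \<subseteq> W"
      using W open_contains_cball by blast
    then show "\<exists>d>0. cball x d \<subseteq> W \<and> uniform_limit (cball x d) F G sequentially"
      using uniform_limit_on_subset[OF unif] by blast
  qed
  with bound show ?thesis by (intro that)
qed

lemma sum_power_from_1_le:
  fixes \<theta> :: real
  assumes "0 < \<theta>" "\<theta> < 1"
  shows "(\<Sum>k=1..n. \<theta> ^ k) \<le> \<theta> / (1 - \<theta>)"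
proof -
  have "(\<Sum>k=1..n. \<theta> ^ k) = (\<theta> - \<theta> ^ Suc n) / (1 - \<theta>)"
    using assms by (simp add: sum_gp)
  also have "\<dots> \<le> \<theta> / (1 - \<theta>)"
    using assms by (intro divide_right_mono) auto
  finally show ?thesis .
qed

text \<open>Dividing the recursion by \<open>A n\<close> gives
  \<open>r n = 1 + (\<Sum>k=1..n. b k * (A (n - k) / A n))\<close>. Of the three powers in
  \<open>\<theta> ^ (3 * k)\<close>, one cancels the backward ratio, of size at most
  \<open>1 / \<theta> ^ k\<close>, one turns \<open>\<theta> ^ (n - k)\<close> into
  \<open>\<theta> ^ n\<close>, and one makes the sum over \<open>k\<close> converge. The bound on
  \<open>\<eta>\<close> closes both inductions, since it implies
  \<open>\<eta> / (1 - \<theta>) \<le> 1 - \<theta>\<close> and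
  \<open>\<eta> * (1 + 1 / (1 - \<theta>)\<^sup>2) \<le> 1\<close>.\<close>

lemma renewal_ratio:
  fixes A b :: "nat \<Rightarrow> complex"
  assumes A0: "A 0 = 1" and rec: "\<And>n. A (Suc n) = (\<Sum>k\<le>n. b k * A (n - k))" and b0: "b 0 = 1"
    and b: "\<And>k. k \<ge> 1 \<Longrightarrow> cmod (b k) \<le> \<eta> * \<theta> ^ (3 * k)"
    and \<theta>: "0 < \<theta>" "\<theta> < 1" and \<eta>: "0 \<le> \<eta>" "\<eta> \<le> (1 - \<theta>)\<^sup>2 / 2"
  shows renewal_nonzero: "A n \<noteq> 0"
    and renewal_ratio_near_1: "cmod (A (Suc n) / A n - 1) \<le> 1 - \<theta>"
    and renewal_ratio_step: "cmod (A (Suc (Suc n)) / A (Suc n) - A (Suc n) / A n) \<le> \<theta> ^ n"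
proof -
  define r where "r n = A (Suc n) / A n" for n
  have rec': "A (Suc n) = A n + (\<Sum>k=1..n. b k * A (n - k))" for n
    unfolding rec atMost_atLeast0 by (subst sum.atLeast_Suc_atMost) (auto simp: b0)
  \<comment> \<open>The middle conjunct is what the recursion consumes: each ratio has modulus at
    least \<open>\<theta>\<close>, so looking back \<open>k\<close> steps costs at most
    \<open>1 / \<theta> ^ k\<close>.\<close>
  have near_1: "A n \<noteq> 0 \<and> (\<forall>k\<le>n. cmod (A (n - k)) \<le> cmod (A n) / \<theta> ^ k) \<and> cmod (r n - 1) \<le> 1 - \<theta>" for n
  proof (induction n)
    case 0
    show ?case
      using rec[of 0] \<theta> by (simp add: A0 b0 r_def)
  next
    case (Suc n)
    then have An: "A n \<noteq> 0" and IH: "\<And>k. k \<le> n \<Longrightarrow> cmod (A (n - k)) \<le> cmod (A n) / \<theta> ^ k"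
      and rn: "cmod (r n - 1) \<le> 1 - \<theta>" by auto
    have "\<theta> \<le> cmod (r n)"
      using norm_triangle_ineq2[of 1 "1 - r n"] rn by (simp add: norm_minus_commute)
    then have r_ge: "\<theta> * cmod (A n) \<le> cmod (A (Suc n))"
      using An by (simp add: r_def norm_divide field_simps)
    then have ASn: "A (Suc n) \<noteq> 0"
      using An \<theta> by (auto simp: mult_le_0_iff)
    have IH': "cmod (A (Suc n - k)) \<le> cmod (A (Suc n)) / \<theta> ^ k" if "k \<le> Suc n" for k
    proof (cases k)
      case (Suc j)
      then have "cmod (A (Suc n - k)) \<le> cmod (A n) / \<theta> ^ j"
        using IH[of j] that by simp
      also have "\<dots> \<le> (cmod (A (Suc n)) / \<theta>) / \<theta> ^ j"
        using r_ge \<theta> by (intro divide_right_mono) (auto simp: field_simps)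
      finally show ?thesis
        using Suc by (simp add: field_simps)
    qed simp
    have "cmod (A (Suc (Suc n)) - A (Suc n)) \<le> (\<Sum>k=1..Suc n. cmod (b k * A (Suc n - k)))"
      unfolding rec'[of "Suc n"] using norm_sum by (simp del: sum.cl_ivl_Suc)
    also have "\<dots> \<le> (\<Sum>k=1..Suc n. \<eta> * cmod (A (Suc n)) * \<theta> ^ k)"
    proof (rule sum_mono)
      fix k assume k: "k \<in> {1..Suc n}"
      have "cmod (b k * A (Suc n - k)) \<le> (\<eta> * \<theta> ^ (3 * k)) * (cmod (A (Suc n)) / \<theta> ^ k)"
        unfolding norm_mult using k \<theta> \<eta> by (intro mult_mono b IH') auto
      also have "\<dots> = \<eta> * cmod (A (Suc n)) * \<theta> ^ (2 * k)"
      proof -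
        have "\<theta> ^ (3 * k) = \<theta> ^ (2 * k) * \<theta> ^ k"
          by (simp add: power_add[symmetric])
        then show ?thesis using \<theta> by simp
      qed
      also have "\<dots> \<le> \<eta> * cmod (A (Suc n)) * \<theta> ^ k"
        using \<theta> \<eta> by (intro mult_left_mono power_decreasing) auto
      finally show "cmod (b k * A (Suc n - k)) \<le> \<eta> * cmod (A (Suc n)) * \<theta> ^ k" .
    qed
    also have "\<dots> \<le> \<eta> * cmod (A (Suc n)) * (\<theta> / (1 - \<theta>))"
      unfolding sum_distrib_left[symmetric] using \<eta> \<theta>
      by (intro mult_left_mono sum_power_from_1_le) auto
    also have "\<dots> \<le> \<eta> * cmod (A (Suc n)) * (1 / (1 - \<theta>))"
      using \<eta> \<theta> by (intro mult_left_mono divide_right_mono) auto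
    also have "\<dots> \<le> ((1 - \<theta>)\<^sup>2) * cmod (A (Suc n)) * (1 / (1 - \<theta>))"
      using \<eta> \<theta> zero_le_power2[of "1 - \<theta>"] by (intro mult_right_mono) auto
    also have "\<dots> = (1 - \<theta>) * cmod (A (Suc n))"
      using \<theta> by (simp add: power2_eq_square)
    finally have "cmod ((r (Suc n) - 1) * A (Suc n)) \<le> (1 - \<theta>) * cmod (A (Suc n))"
      using ASn by (simp add: r_def algebra_simps)
    then have "cmod (r (Suc n) - 1) \<le> 1 - \<theta>"
      using ASn by (simp add: norm_mult)
    with ASn IH' show ?case by blast
  qed
  then have nz: "A n \<noteq> 0" and r1: "cmod (r n - 1) \<le> 1 - \<theta>" for n by auto
  have ratio: "cmod (A (n - k) / A n) \<le> 1 / \<theta> ^ k" if "k \<le> n" for n k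
    using near_1[of n] that by (simp add: norm_divide divide_le_eq)
  have r_eq: "r n = 1 + (\<Sum>k=1..n. b k * (A (n - k) / A n))" for n
    using nz[of n] by (simp add: r_def rec' add_divide_distrib sum_divide_distrib)
  have step: "cmod (r (Suc n) - r n) \<le> \<theta> ^ n" for n
  proof (induction n rule: less_induct)
    case (less n)
    \<comment> \<open>Telescoping involves only increments with index below \<open>n\<close>, which
      the strong induction supplies.\<close>
    have diff: "cmod (r n - r (n - k)) \<le> \<theta> ^ (n - k) / (1 - \<theta>)" if "k \<le> n" for k
    proof -
      have "cmod (r (j + i) - r j) \<le> \<theta> ^ j * (\<Sum>l<i. \<theta> ^ l)" if "j + i \<le> n" for i j
        using that
      proof (induction i)
        case (Suc i)
        have "cmod (r (j + Suc i) - r j) \<le> cmod (r (Suc (j + i)) - r (j + i)) + cmod (r (j + i) - r j)"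
          using norm_triangle_ineq[of "r (Suc (j + i)) - r (j + i)" "r (j + i) - r j"] by simp
        with Suc less.IH[of "j + i"] show ?case
          by (simp add: power_add algebra_simps)
      qed simp
      from this[of "n - k" k] that have "cmod (r n - r (n - k)) \<le> \<theta> ^ (n - k) * (\<Sum>l<k. \<theta> ^ l)"
        by simp
      also have "\<dots> \<le> \<theta> ^ (n - k) * (1 / (1 - \<theta>))"
        using \<theta> by (intro mult_left_mono) (auto simp: sum_gp_strict divide_right_mono)
      finally show ?thesis by simp
    qed
    \<comment> \<open>The backward ratio changes from \<open>n\<close> to \<open>Suc n\<close> only
      through \<open>r (n - k) - r n\<close>; here the smallness of earlier increments
      enters.\<close>
    have shift: "A (Suc n - k) / A (Suc n) - A (n - k) / A n
        = (A (n - k) / A n) * (A n / A (Suc n)) * (r (n - k) - r n)" if "k \<le> n" for k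
      using that nz by (simp add: r_def Suc_diff_le field_simps)
    have inv: "cmod (A n / A (Suc n)) \<le> 1 / \<theta>"
      using ratio[of 1 "Suc n"] by simp
    \<comment> \<open>The summand \<open>k = Suc n\<close> has no counterpart in \<open>r n\<close>
      and is split off; the others pair up.\<close>
    have "r (Suc n) - r n = b (Suc n) * (A 0 / A (Suc n))
        + (\<Sum>k=1..n. b k * (A (Suc n - k) / A (Suc n) - A (n - k) / A n))"
      unfolding r_eq[of "Suc n"] r_eq[of n] by (simp add: right_diff_distrib sum_subtractf)
    also have "cmod \<dots> \<le> cmod (b (Suc n) * (A 0 / A (Suc n)))
        + (\<Sum>k=1..n. cmod (b k * (A (Suc n - k) / A (Suc n) - A (n - k) / A n)))"
      by (intro norm_triangle_mono order_refl norm_sum)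
    also have "\<dots> \<le> \<eta> * \<theta> ^ n + (\<Sum>k=1..n. \<eta> * \<theta> ^ n / (\<theta> * (1 - \<theta>)) * \<theta> ^ k)"
    proof (intro add_mono sum_mono)
      have "cmod (b (Suc n) * (A 0 / A (Suc n))) \<le> (\<eta> * \<theta> ^ (3 * Suc n)) * (1 / \<theta> ^ Suc n)"
        unfolding norm_mult using ratio[of "Suc n" "Suc n"] \<eta> \<theta> by (intro mult_mono b) auto
      also have "\<dots> = \<eta> * \<theta> ^ (2 * Suc n)"
      proof -
        have "\<theta> ^ (3 * Suc n) = \<theta> ^ (2 * Suc n) * \<theta> ^ Suc n"
          unfolding power_add[symmetric] by (rule arg_cong[where f = "(^) \<theta>"]) simp
        then show ?thesis using \<theta> by simp
      qed
      also have "\<dots> \<le> \<eta> * \<theta> ^ n"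
        using \<theta> \<eta> by (intro mult_left_mono power_decreasing) auto
      finally show "cmod (b (Suc n) * (A 0 / A (Suc n))) \<le> \<eta> * \<theta> ^ n" .
    next
      fix k assume k: "k \<in> {1..n}"
      have kn: "k \<le> n" using k by simp
      have "cmod (A (n - k) / A n) * cmod (A n / A (Suc n)) * cmod (r (n - k) - r n)
          \<le> (1 / \<theta> ^ k) * (1 / \<theta>) * (\<theta> ^ (n - k) / (1 - \<theta>))"
        using \<theta> diff[OF kn] unfolding norm_minus_commute[of "r (n - k)"]
        by (intro mult_mono ratio[OF kn] inv mult_nonneg_nonneg) auto
      then have "cmod (A (Suc n - k) / A (Suc n) - A (n - k) / A n)
          \<le> (1 / \<theta> ^ k) * (1 / \<theta>) * (\<theta> ^ (n - k) / (1 - \<theta>))"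
        unfolding shift[OF kn] norm_mult .
      then have "cmod (b k * (A (Suc n - k) / A (Suc n) - A (n - k) / A n))
          \<le> (\<eta> * \<theta> ^ (3 * k)) * ((1 / \<theta> ^ k) * (1 / \<theta>) * (\<theta> ^ (n - k) / (1 - \<theta>)))"
        unfolding norm_mult using k \<eta> \<theta> by (intro mult_mono b) auto
      also have "\<dots> = \<eta> * \<theta> ^ n / (\<theta> * (1 - \<theta>)) * \<theta> ^ k"
      proof -
        have "\<theta> ^ (3 * k) * \<theta> ^ (n - k) = \<theta> ^ n * \<theta> ^ k * \<theta> ^ k"
          using k unfolding power_add[symmetric] by (intro arg_cong[where f = "(^) \<theta>"]) auto
        then show ?thesis
          using \<theta> by (simp add: field_simps)
      qed
      finally show "cmod (b k * (A (Suc n - k) / A (Suc n) - A (n - k) / A n))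
          \<le> \<eta> * \<theta> ^ n / (\<theta> * (1 - \<theta>)) * \<theta> ^ k" .
    qed
    also have "\<dots> \<le> \<eta> * \<theta> ^ n + \<eta> * \<theta> ^ n / (\<theta> * (1 - \<theta>)) * (\<theta> / (1 - \<theta>))"
      unfolding sum_distrib_left[symmetric] using \<eta> \<theta>
      by (intro add_left_mono mult_left_mono sum_power_from_1_le) auto
    also have "\<dots> = \<eta> * \<theta> ^ n * (1 + 1 / (1 - \<theta>)\<^sup>2)"
      unfolding distrib_left using \<theta> by (simp add: power2_eq_square)
    also have "\<dots> \<le> \<eta> * \<theta> ^ n * (2 / (1 - \<theta>)\<^sup>2)"
    proof (rule mult_left_mono)
      have "(1 - \<theta>)\<^sup>2 \<le> 1" "(1 - \<theta>)\<^sup>2 > 0"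
        using \<theta> by (auto simp: power_le_one)
      then have "1 \<le> 1 / (1 - \<theta>)\<^sup>2"
        by simp
      moreover have "2 / (1 - \<theta>)\<^sup>2 = 1 / (1 - \<theta>)\<^sup>2 + 1 / (1 - \<theta>)\<^sup>2"
        by simp
      ultimately show "1 + 1 / (1 - \<theta>)\<^sup>2 \<le> 2 / (1 - \<theta>)\<^sup>2"
        by linarith
    qed (use \<eta> \<theta> in auto)
    also have "\<dots> \<le> ((1 - \<theta>)\<^sup>2 / 2) * \<theta> ^ n * (2 / (1 - \<theta>)\<^sup>2)"
      using \<eta> \<theta> by (intro mult_right_mono) auto
    also have "\<dots> = \<theta> ^ n"
      using \<theta> by simp
    finally show ?case .
  qed
  show "A n \<noteq> 0" "cmod (A (Suc n) / A n - 1) \<le> 1 - \<theta>"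
    "cmod (A (Suc (Suc n)) / A (Suc n) - A (Suc n) / A n) \<le> \<theta> ^ n"
    using nz r1 step by (auto simp: r_def)
qed

lemma zero_if_geometrically_small:
  fixes x :: complex
  assumes "\<And>n. cmod x \<le> c * \<theta> ^ n" "0 < \<theta>" "\<theta> < 1"
  shows "x = 0"
proof -
  have "(\<lambda>n. c * \<theta> ^ n) \<longlonglongrightarrow> c * 0"
    using assms by (intro tendsto_intros LIMSEQ_realpow_zero) auto
  then have "cmod x \<le> c * 0"
    by (rule LIMSEQ_le_const) (use assms in auto)
  then show ?thesis by simp
qed

text \<open>The ratios converge to some \<open>l\<close>. The quotients
  \<open>\<alpha> n z = A n z / l z ^ n\<close> then have relative increments of geometric size and
  converge to some \<open>a\<close>. Since \<open>A (Suc n)\<close> is \<open>l ^ n\<close> times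
  \<open>l * a + l * (\<alpha> (Suc n) - a)\<close>, the exponent is \<open>Ln\<close> of
  \<open>l\<close>, and the index shift puts a factor \<open>l\<close> into \<open>u\<close> and
  \<open>dn\<close>.\<close>

lemma renewal_expansion:
  fixes A b :: "nat \<Rightarrow> complex \<Rightarrow> complex"
  assumes W: "open W" "0 \<in> W" and hol: "\<And>n. A n holomorphic_on W"
    and A0: "\<And>z. z \<in> W \<Longrightarrow> A 0 z = 1"
    and rec: "\<And>n z. z \<in> W \<Longrightarrow> A (Suc n) z = (\<Sum>k\<le>n. b k z * A (n - k) z)"
    and b0: "\<And>z. z \<in> W \<Longrightarrow> b 0 z = 1"
    and b: "\<And>k z. z \<in> W \<Longrightarrow> k \<ge> 1 \<Longrightarrow> cmod (b k z) \<le> (1 - \<theta>)\<^sup>2 / 2 * \<theta> ^ (3 * k)"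
    and \<theta>: "0 < \<theta>" "\<theta> < 1" and at_0: "\<And>n. A n 0 = 1"
  obtains Pi u dn C where "Pi holomorphic_on W" "u holomorphic_on W" "\<And>n. dn n holomorphic_on W"
    "C > 0" "Pi 0 = 0" "u 0 = 1" "\<And>n z. z \<in> W \<Longrightarrow> cmod (dn n z) \<le> C * \<theta> ^ n"
    "\<And>n z. z \<in> W \<Longrightarrow> A (Suc n) z = exp (of_nat n * Pi z) * (u z + dn n z)"
proof -
  have \<eta>: "0 \<le> (1 - \<theta>)\<^sup>2 / 2" "(1 - \<theta>)\<^sup>2 / 2 \<le> (1 - \<theta>)\<^sup>2 / 2"
    by auto
  have nz: "A n z \<noteq> 0" and near_1: "cmod (A (Suc n) z / A n z - 1) \<le> 1 - \<theta>"
    and step: "cmod (A (Suc (Suc n)) z / A (Suc n) z - A (Suc n) z / A n z) \<le> \<theta> ^ n"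
    if z: "z \<in> W" for n z
  proof -
    have *: "A 0 z = 1" "\<And>n. A (Suc n) z = (\<Sum>k\<le>n. b k z * A (n - k) z)" "b 0 z = 1"
      "\<And>k. k \<ge> 1 \<Longrightarrow> cmod (b k z) \<le> (1 - \<theta>)\<^sup>2 / 2 * \<theta> ^ (3 * k)"
      using A0 rec b0 b z by auto
    show "A n z \<noteq> 0"
      using renewal_nonzero[of "\<lambda>n. A n z" "\<lambda>k. b k z", OF * \<theta> \<eta>] .
    show "cmod (A (Suc n) z / A n z - 1) \<le> 1 - \<theta>"
      using renewal_ratio_near_1[of "\<lambda>n. A n z" "\<lambda>k. b k z", OF * \<theta> \<eta>] .
    show "cmod (A (Suc (Suc n)) z / A (Suc n) z - A (Suc n) z / A n z) \<le> \<theta> ^ n"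
      using renewal_ratio_step[of "\<lambda>n. A n z" "\<lambda>k. b k z", OF * \<theta> \<eta>] .
  qed
  define r where "r n z = A (Suc n) z / A n z" for n z
  have "r n holomorphic_on W" for n
    unfolding r_def using nz by (intro holomorphic_intros hol) auto
  moreover have "cmod (r (Suc n) z - r n z) \<le> 1 * \<theta> ^ n" if "z \<in> W" for n z
    using step[OF that] by (simp add: r_def)
  ultimately obtain l where l: "l holomorphic_on W"
      "\<And>n z. z \<in> W \<Longrightarrow> cmod (r n z - l z) \<le> 1 * \<theta> ^ n / (1 - \<theta>)"
    using holomorphic_geometric_limit[OF W(1) _ _ \<theta>, of r 1] by blast
  have l1: "cmod (l z - 1) \<le> 1 - \<theta>" if z: "z \<in> W" for z
  proof (rule LIMSEQ_le_const)
    have "(\<lambda>n. \<theta> ^ n / (1 - \<theta>) + (1 - \<theta>)) \<longlonglongrightarrow> 0 / (1 - \<theta>) + (1 - \<theta>)"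
      using \<theta> by (intro tendsto_intros LIMSEQ_realpow_zero) auto
    then show "(\<lambda>n. \<theta> ^ n / (1 - \<theta>) + (1 - \<theta>)) \<longlonglongrightarrow> 1 - \<theta>" by simp
    have "cmod (l z - 1) \<le> \<theta> ^ n / (1 - \<theta>) + (1 - \<theta>)" for n
      using norm_triangle_ineq[of "l z - r n z" "r n z - 1"] l(2)[OF z, of n] near_1[OF z, of n]
      by (simp add: r_def norm_minus_commute)
    then show "\<exists>N. \<forall>n\<ge>N. cmod (l z - 1) \<le> \<theta> ^ n / (1 - \<theta>) + (1 - \<theta>)" by blast
  qed
  \<comment> \<open>The disc of radius \<open>1 - \<theta>\<close> around 1 lies in the right
    half-plane, where \<open>Ln\<close> is holomorphic; the lower bound \<open>\<theta>\<close>
    controls division by \<open>l\<close>.\<close>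
  have l_ge: "\<theta> \<le> cmod (l z)" and l_le: "cmod (l z) \<le> 2" and l_Re: "0 < Re (l z)" if z: "z \<in> W" for z
    using norm_triangle_ineq2[of 1 "1 - l z"] norm_triangle_ineq[of 1 "l z - 1"] l1[OF z] \<theta>
      abs_Re_le_cmod[of "l z - 1"] by (auto simp: norm_minus_commute)
  have l_nz: "l z \<noteq> 0" if "z \<in> W" for z
    using l_Re[OF that] by auto
  define \<alpha> where "\<alpha> n z = A n z / l z ^ n" for n z
  define c where "c = 1 / (\<theta> * (1 - \<theta>))"
  define M where "M = exp (c / (1 - \<theta>))"
  have c: "c > 0" using \<theta> by (simp add: c_def)
  have M: "M > 0" by (simp add: M_def)
  have \<alpha>_step: "cmod (\<alpha> (Suc n) z - \<alpha> n z) \<le> cmod (\<alpha> n z) * (c * \<theta> ^ n)" if z: "z \<in> W" for n z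
  proof -
    have eq: "\<alpha> (Suc n) z - \<alpha> n z = \<alpha> n z * ((r n z - l z) / l z)"
      using nz[OF z, of n] l_nz[OF z] by (simp add: \<alpha>_def r_def field_simps)
    have "cmod ((r n z - l z) / l z) \<le> (\<theta> ^ n / (1 - \<theta>)) / \<theta>"
      unfolding norm_divide using l(2)[OF z, of n] l_ge[OF z] \<theta> by (intro frac_le) auto
    then show ?thesis
      unfolding eq norm_mult by (intro mult_left_mono) (simp_all add: c_def mult.commute)
  qed
  have \<alpha>_bound: "cmod (\<alpha> n z) \<le> M" if z: "z \<in> W" for n z
  proof -
    \<comment> \<open>The growth factors \<open>1 + c * \<theta> ^ j\<close> multiply to at most the
      exponential of a convergent sum.\<close>
    have "cmod (\<alpha> n z) \<le> exp (c * (\<Sum>j<n. \<theta> ^ j))"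
    proof (induction n)
      case 0
      then show ?case by (simp add: \<alpha>_def A0 z)
    next
      case (Suc n)
      have "cmod (\<alpha> (Suc n) z) \<le> cmod (\<alpha> n z) * (1 + c * \<theta> ^ n)"
        using norm_triangle_ineq[of "\<alpha> (Suc n) z - \<alpha> n z" "\<alpha> n z"] \<alpha>_step[OF z, of n]
        by (simp add: algebra_simps)
      also have "\<dots> \<le> exp (c * (\<Sum>j<n. \<theta> ^ j)) * exp (c * \<theta> ^ n)"
        using c \<theta> by (intro mult_mono Suc exp_ge_add_one_self) auto
      finally show ?case
        by (simp add: exp_add[symmetric] algebra_simps)
    qed
    also have "\<dots> \<le> M"
      unfolding M_def using c \<theta> mult_left_mono[of "\<Sum>j<n. \<theta> ^ j" "1 / (1 - \<theta>)" c]
      by (simp add: sum_gp_strict divide_right_mono)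
    finally show ?thesis .
  qed
  have \<alpha>_hol: "\<alpha> n holomorphic_on W" for n
    unfolding \<alpha>_def using l_nz by (intro holomorphic_intros hol l) auto
  moreover have "cmod (\<alpha> (Suc n) z - \<alpha> n z) \<le> (M * c) * \<theta> ^ n" if z: "z \<in> W" for n z
    using order_trans[OF \<alpha>_step[OF z] mult_right_mono[OF \<alpha>_bound[OF z]]] c \<theta> by (simp add: mult.assoc)
  ultimately obtain a where a: "a holomorphic_on W"
      "\<And>n z. z \<in> W \<Longrightarrow> cmod (\<alpha> n z - a z) \<le> (M * c) * \<theta> ^ n / (1 - \<theta>)"
    using holomorphic_geometric_limit[OF W(1) _ _ \<theta>, of \<alpha> "M * c"] by blast
  \<comment> \<open>At 0 all ratios, and then all \<open>\<alpha> n\<close>, equal 1, so both limits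
    do.\<close>
  have l_0: "l 0 = 1"
    using zero_if_geometrically_small[of "1 - l 0" "1 / (1 - \<theta>)", OF _ \<theta>] l(2)[OF W(2)]
    by (simp add: r_def at_0)
  have a_0: "a 0 = 1"
    using zero_if_geometrically_small[of "1 - a 0" "M * c / (1 - \<theta>)", OF _ \<theta>] a(2)[OF W(2)]
    by (simp add: \<alpha>_def at_0 l_0)
  define dn where "dn n z = l z * (\<alpha> (Suc n) z - a z)" for n z
  show ?thesis
  proof (rule that[of "\<lambda>z. Ln (l z)" "\<lambda>z. l z * a z" dn "2 * (M * c / (1 - \<theta>))"])
    show "(\<lambda>z. Ln (l z)) holomorphic_on W"
      using l_Re by (intro holomorphic_intros l) (auto simp: complex_nonpos_Reals_iff dest!: l_Re)
    show "(\<lambda>z. l z * a z) holomorphic_on W" "\<And>n. dn n holomorphic_on W"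
      unfolding dn_def by (intro holomorphic_intros l a \<alpha>_hol)+
    show "2 * (M * c / (1 - \<theta>)) > 0"
      using M c \<theta> by simp
    show "Ln (l 0) = 0" "l 0 * a 0 = 1"
      by (simp_all add: l_0 a_0)
    show "cmod (dn n z) \<le> 2 * (M * c / (1 - \<theta>)) * \<theta> ^ n" if z: "z \<in> W" for n z
    proof -
      have "cmod (dn n z) \<le> 2 * ((M * c) * \<theta> ^ Suc n / (1 - \<theta>))"
        unfolding dn_def norm_mult by (rule mult_mono[OF l_le[OF z] a(2)[OF z]]) auto
      also have "\<dots> \<le> 2 * ((M * c) * \<theta> ^ n / (1 - \<theta>))"
        using M c \<theta> by (intro mult_left_mono divide_right_mono power_decreasing) auto
      finally show ?thesis by simp
    qed
    show "A (Suc n) z = exp (of_nat n * Ln (l z)) * (l z * a z + dn n z)" if z: "z \<in> W" for n z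
      using l_nz[OF z] by (simp add: exp_of_nat_mult dn_def \<alpha>_def algebra_simps)
  qed
qed

subsection \<open>Second derivative at the origin\<close>

text \<open>Because \<open>a n 0 = 1\<close>, the difference a''(0) - a'(0)^2 is the second
  derivative of log a at 0. It equals n Pi''(0) plus the same expression for
  \<open>\<phi> n = u + dn n\<close>, which stays bounded and vanishes after division by n.\<close>

lemma second_deriv_exp_family:
  fixes Pi u :: "complex \<Rightarrow> complex" and dn a :: "nat \<Rightarrow> complex \<Rightarrow> complex"
  assumes W: "open W" "0 \<in> W" and hol: "Pi holomorphic_on W" "u holomorphic_on W" "\<And>n. dn n holomorphic_on W"
    and dn: "\<And>n z. z \<in> W \<Longrightarrow> cmod (dn n z) \<le> C" and Pi0: "Pi 0 = 0"
    and a: "\<And>n z. z \<in> W \<Longrightarrow> a n z = exp (of_nat n * Pi z) * (u z + dn n z)" and a0: "\<And>n. a n 0 = 1"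
    and lim: "(\<lambda>n. ((deriv ^^ 2) (a n) 0 - (deriv (a n) 0)\<^sup>2) / of_nat n) \<longlonglongrightarrow> s"
  shows "(deriv ^^ 2) Pi 0 = s"
proof -
  obtain r where r: "r > 0" "cball 0 r \<subseteq> W"
    using W open_contains_cball by blast
  have cont: "continuous_on (cball 0 r) g" if "g holomorphic_on W" for g
    by (rule holomorphic_on_imp_continuous_on[OF holomorphic_on_subset[OF that r(2)]])
  have "bounded (u ` cball 0 r)"
    by (intro compact_imp_bounded compact_continuous_image cont hol compact_cball)
  then obtain K where "\<forall>z\<in>cball 0 r. cmod (u z) \<le> K"
    by (auto simp: bounded_iff)
  then have K: "cmod (u z) \<le> K" if "z \<in> cball 0 r" for z
    using that by blast
  define \<phi> where "\<phi> n z = u z + dn n z" for n z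
  have \<phi>_hol: "\<phi> n holomorphic_on W" for n
    unfolding \<phi>_def by (intro holomorphic_intros hol)
  have \<phi>_bound: "cmod (\<phi> n z) \<le> K + C" if "z \<in> cball 0 r" for n z
    unfolding \<phi>_def using that r(2) by (intro norm_triangle_mono K dn) auto
  \<comment> \<open>Cauchy's inequality on one circle for all \<open>n\<close> gives bounds
    independent of \<open>n\<close>.\<close>
  have \<phi>_deriv: "cmod ((deriv ^^ k) (\<phi> n) 0) \<le> fact k * (K + C) / r ^ k" for k n
  proof (rule Cauchy_inequality)
    show "\<phi> n holomorphic_on ball 0 r"
      by (rule holomorphic_on_subset[OF \<phi>_hol order_trans[OF ball_subset_cball r(2)]])
    show "continuous_on (cball 0 r) (\<phi> n)"
      by (rule cont[OF \<phi>_hol])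
    show "cmod (\<phi> n x) \<le> K + C" if "cmod (0 - x) = r" for x
      using that by (intro \<phi>_bound) auto
  qed (use r in auto)
  have d1: "(g has_field_derivative deriv g z) (at z)" if "g holomorphic_on W" "z \<in> W" for g z
    by (rule holomorphic_derivI[OF that(1) W(1) that(2)])
  have \<phi>0: "\<phi> n 0 = 1" for n
    using a[OF W(2), of n] a0[of n] by (simp add: \<phi>_def Pi0)
  have exp_deriv: "((\<lambda>z. exp (of_nat n * Pi z)) has_field_derivative
      exp (of_nat n * Pi z) * (of_nat n * deriv Pi z)) (at z)" if "z \<in> W" for n z
    by (intro DERIV_fun_exp DERIV_cmult d1[OF hol(1) that])
  have a_deriv: "deriv (a n) z = exp (of_nat n * Pi z) * (of_nat n * deriv Pi z * \<phi> n z + deriv (\<phi> n) z)"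
    if z: "z \<in> W" for n z
  proof -
    have "((\<lambda>z. exp (of_nat n * Pi z) * \<phi> n z) has_field_derivative
        exp (of_nat n * Pi z) * (of_nat n * deriv Pi z * \<phi> n z + deriv (\<phi> n) z)) (at z)"
      using DERIV_mult[OF exp_deriv[OF z, of n] d1[OF \<phi>_hol[of n] z]] by (simp add: algebra_simps)
    then have "(a n has_field_derivative
        exp (of_nat n * Pi z) * (of_nat n * deriv Pi z * \<phi> n z + deriv (\<phi> n) z)) (at z)"
      by (rule has_field_derivative_transform_within_open[OF _ W(1) z]) (simp add: a \<phi>_def)
    then show ?thesis
      by (rule DERIV_imp_deriv)
  qed
  have a_deriv2: "(deriv ^^ 2) (a n) 0 - (deriv (a n) 0)\<^sup>2
      = of_nat n * (deriv ^^ 2) Pi 0 + ((deriv ^^ 2) (\<phi> n) 0 - (deriv (\<phi> n) 0)\<^sup>2)" for n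
  proof -
    have "((\<lambda>z. exp (of_nat n * Pi z) * (of_nat n * deriv Pi z * \<phi> n z + deriv (\<phi> n) z))
        has_field_derivative (of_nat n * deriv Pi 0) * (of_nat n * deriv Pi 0 + deriv (\<phi> n) 0)
          + (of_nat n * deriv (deriv Pi) 0 + of_nat n * deriv Pi 0 * deriv (\<phi> n) 0 + deriv (deriv (\<phi> n)) 0)) (at 0)"
      using DERIV_mult[OF exp_deriv[OF W(2), of n] DERIV_add[OF DERIV_mult[OF DERIV_cmult[OF
            d1[OF holomorphic_deriv[OF hol(1) W(1)] W(2)], of "of_nat n"] d1[OF \<phi>_hol[of n] W(2)]]
          d1[OF holomorphic_deriv[OF \<phi>_hol[of n] W(1)] W(2)]]]
      by (simp add: \<phi>0 Pi0 algebra_simps)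
    then have "(deriv (a n) has_field_derivative (of_nat n * deriv Pi 0) * (of_nat n * deriv Pi 0 + deriv (\<phi> n) 0)
          + (of_nat n * deriv (deriv Pi) 0 + of_nat n * deriv Pi 0 * deriv (\<phi> n) 0 + deriv (deriv (\<phi> n)) 0)) (at 0)"
      by (rule has_field_derivative_transform_within_open[OF _ W]) (simp add: a_deriv)
    then have "deriv (deriv (a n)) 0 = (of_nat n * deriv Pi 0) * (of_nat n * deriv Pi 0 + deriv (\<phi> n) 0)
          + (of_nat n * deriv (deriv Pi) 0 + of_nat n * deriv Pi 0 * deriv (\<phi> n) 0 + deriv (deriv (\<phi> n)) 0)"
      by (rule DERIV_imp_deriv)
    then show ?thesis
      using W(2) by (simp add: eval_nat_numeral a_deriv Pi0 \<phi>0 algebra_simps)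
  qed
  define e where "e n = (deriv ^^ 2) (\<phi> n) 0 - (deriv (\<phi> n) 0)\<^sup>2" for n
  define D where "D = 2 * (K + C) / r\<^sup>2 + ((K + C) / r)\<^sup>2"
  have e_bound: "cmod (e n) \<le> D" for n
  proof -
    have "cmod (deriv (\<phi> n) 0) \<le> (K + C) / r"
      using \<phi>_deriv[of 1 n] by simp
    then have "(cmod (deriv (\<phi> n) 0))\<^sup>2 \<le> ((K + C) / r)\<^sup>2"
      by (rule power_mono) simp
    then show ?thesis
      using norm_triangle_ineq4[of "(deriv ^^ 2) (\<phi> n) 0" "(deriv (\<phi> n) 0)\<^sup>2"] \<phi>_deriv[of 2 n]
      by (simp add: e_def D_def norm_power)
  qed
  have "(\<lambda>n. e n / of_nat n) \<longlonglongrightarrow> 0"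
  proof (rule Lim_null_comparison)
    show "\<forall>\<^sub>F n in sequentially. norm (e n / of_nat n) \<le> D / real n"
      by (intro always_eventually allI) (simp add: norm_divide divide_right_mono e_bound)
    show "(\<lambda>n. D / real n) \<longlonglongrightarrow> 0"
      by (rule lim_const_over_n)
  qed
  then have "(\<lambda>n. (deriv ^^ 2) Pi 0 + e n / of_nat n) \<longlonglongrightarrow> (deriv ^^ 2) Pi 0 + 0"
    by (intro tendsto_intros)
  \<comment> \<open>At \<open>n = 0\<close> the left side is 0 by the convention for division, so
    equality is claimed only eventually.\<close>
  moreover have "\<forall>\<^sub>F n in sequentially. ((deriv ^^ 2) (a n) 0 - (deriv (a n) 0)\<^sup>2) / of_nat n
      = (deriv ^^ 2) Pi 0 + e n / of_nat n"
    using eventually_gt_at_top[of 0]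
    by eventually_elim (simp add: a_deriv2 e_def add_divide_distrib)
  ultimately have "(\<lambda>n. ((deriv ^^ 2) (a n) 0 - (deriv (a n) 0)\<^sup>2) / of_nat n) \<longlonglongrightarrow> (deriv ^^ 2) Pi 0 + 0"
    by (simp add: filterlim_cong)
  from LIMSEQ_unique[OF this lim] show ?thesis
    by simp
qed

text \<open>The sum \<open>G\<close> of the two exponentials dominates all partial sums of the
  exponential series of |z S| for \<open>cmod z < t\<close>. The series may thus be integrated
  termwise, and \<open>\<phi>\<close> is a power series whose coefficients are the moments over
  factorials.\<close>

lemma (in prob_space) moment_generating_function:
  fixes S :: "'a \<Rightarrow> real"
  assumes S [measurable]: "random_variable borel S" and t: "t > 0"
    and int: "integrable M (\<lambda>\<omega>. exp (t * S \<omega>))" "integrable M (\<lambda>\<omega>. exp (- t * S \<omega>))"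
  defines "\<phi> \<equiv> \<lambda>z. expectation (\<lambda>\<omega>. exp (z * complex_of_real (S \<omega>)))"
  shows mgf_holomorphic: "\<phi> holomorphic_on ball 0 t"
    and mgf_integrable_moment: "integrable M (\<lambda>\<omega>. S \<omega> ^ k)"
    and mgf_higher_deriv: "(deriv ^^ k) \<phi> 0 = of_real (expectation (\<lambda>\<omega>. S \<omega> ^ k))"
proof -
  define G where "G \<omega> = exp (t * S \<omega>) + exp (- t * S \<omega>)" for \<omega>
  have G: "integrable M G"
    unfolding G_def by (intro Bochner_Integration.integrable_add int)
  have exp_le_G: "exp (s * \<bar>S \<omega>\<bar>) \<le> G \<omega>" if "s \<le> t" for s \<omega>
  proof -
    have "exp (s * \<bar>S \<omega>\<bar>) \<le> exp (t * \<bar>S \<omega>\<bar>)"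
      using that by (simp add: mult_right_mono)
    also have "\<dots> \<le> G \<omega>"
      unfolding G_def by (cases "S \<omega> \<ge> 0") (auto simp: abs_if)
    finally show ?thesis .
  qed
  have partial_le: "(\<Sum>k<n. \<bar>s * S \<omega>\<bar> ^ k / fact k) \<le> G \<omega>" if "0 \<le> s" "s \<le> t" for s n \<omega>
  proof -
    have "(\<lambda>k. \<bar>s * S \<omega>\<bar> ^ k / fact k) sums exp (s * \<bar>S \<omega>\<bar>)"
      using exp_converges[of "s * \<bar>S \<omega>\<bar>"] that by (simp add: abs_mult divide_inverse mult.commute)
    then have "(\<Sum>k<n. \<bar>s * S \<omega>\<bar> ^ k / fact k) \<le> exp (s * \<bar>S \<omega>\<bar>)"
      by (intro sums_le[OF _ sums_If_finite_set[of "{..<n}"], THEN order_trans]) (auto simp: sums_iff)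
    also have "\<dots> \<le> G \<omega>"
      by (rule exp_le_G[OF that(2)])
    finally show ?thesis .
  qed
  have term_le: "\<bar>s * S \<omega>\<bar> ^ k / fact k \<le> G \<omega>" if "0 \<le> s" "s \<le> t" for s k \<omega>
  proof -
    have "\<bar>s * S \<omega>\<bar> ^ k / fact k \<le> (\<Sum>k<Suc k. \<bar>s * S \<omega>\<bar> ^ k / fact k)"
      by (rule member_le_sum) auto
    also have "\<dots> \<le> G \<omega>" by (rule partial_le[OF that])
    finally show ?thesis .
  qed
  have term_int: "integrable M (\<lambda>\<omega>. \<bar>s * S \<omega>\<bar> ^ k / fact k)" if "0 \<le> s" "s \<le> t" for s k
    by (rule Bochner_Integration.integrable_bound[OF G])
      (auto intro!: AE_I2 order_trans[OF term_le[OF that]])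
  have moment: "integrable M (\<lambda>\<omega>. S \<omega> ^ k)" for k
  proof (rule Bochner_Integration.integrable_bound)
    show "integrable M (\<lambda>\<omega>. fact k / t ^ k * (\<bar>t * S \<omega>\<bar> ^ k / fact k))"
      using t by (intro integrable_mult_right term_int) auto
    show "AE \<omega> in M. norm (S \<omega> ^ k) \<le> norm (fact k / t ^ k * (\<bar>t * S \<omega>\<bar> ^ k / fact k))"
      using t by (intro AE_I2) (simp add: power_abs abs_mult power_mult_distrib)
  qed simp
  show "integrable M (\<lambda>\<omega>. S \<omega> ^ k)"
    by (rule moment)
  define c where "c k = complex_of_real (expectation (\<lambda>\<omega>. S \<omega> ^ k)) / fact k" for k
  have series: "(\<lambda>k. c k * z ^ k) sums \<phi> z" if z: "cmod z < t" for z
  proof -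
    define f where "f k \<omega> = (z * of_real (S \<omega>)) ^ k /\<^sub>R fact k" for k \<omega>
    have nf: "norm (f k \<omega>) = \<bar>cmod z * S \<omega>\<bar> ^ k / fact k" for k \<omega>
      by (simp add: f_def norm_mult norm_power abs_mult divide_inverse mult.commute)
    have f_sums: "(\<lambda>k. f k \<omega>) sums exp (z * of_real (S \<omega>))" for \<omega>
      unfolding f_def by (rule exp_converges)
    have f_int: "integrable M (f k)" for k
    proof (rule Bochner_Integration.integrable_bound)
      show "integrable M (\<lambda>\<omega>. \<bar>cmod z * S \<omega>\<bar> ^ k / fact k)"
        using z by (intro term_int) auto
      show "f k \<in> borel_measurable M"
        unfolding f_def by measurable
    qed (auto simp: nf)
    have "(\<lambda>k. integral\<^sup>L M (f k)) sums (\<integral>\<omega>. (\<Sum>k. f k \<omega>) \<partial>M)"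
    proof (rule sums_integral[OF f_int])
      show "AE \<omega> in M. summable (\<lambda>k. norm (f k \<omega>))"
        using summable_norm_exp[of "z * of_real (S _)"] by (intro AE_I2) (simp add: f_def)
      show "summable (\<lambda>k. \<integral>\<omega>. norm (f k \<omega>) \<partial>M)"
      proof (rule summableI_nonneg_bounded)
        fix n
        have "(\<Sum>k<n. \<integral>\<omega>. norm (f k \<omega>) \<partial>M) = (\<integral>\<omega>. (\<Sum>k<n. norm (f k \<omega>)) \<partial>M)"
          by (intro Bochner_Integration.integral_sum[symmetric] integrable_norm f_int)
        also have "\<dots> \<le> expectation G"
          using z by (intro integral_mono Bochner_Integration.integrable_sum integrable_norm f_int G)
            (auto simp: nf intro!: partial_le)
        finally show "(\<Sum>k<n. \<integral>\<omega>. norm (f k \<omega>) \<partial>M) \<le> expectation G" .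
      qed simp
    qed
    moreover have "(\<Sum>k. f k \<omega>) = exp (z * of_real (S \<omega>))" for \<omega>
      using f_sums by (rule sums_unique[symmetric])
    moreover have "integral\<^sup>L M (f k) = c k * z ^ k" for k
    proof -
      have "f k = (\<lambda>\<omega>. (z ^ k / fact k) * of_real (S \<omega> ^ k))"
        by (auto simp: f_def power_mult_distrib scaleR_conv_of_real field_simps)
      then have "integral\<^sup>L M (f k) = (z ^ k / fact k) * (\<integral>\<omega>. complex_of_real (S \<omega> ^ k) \<partial>M)"
        by (simp del: of_real_power)
      then show ?thesis
        unfolding integral_complex_of_real c_def by simp
    qed
    ultimately show ?thesis
      by (simp add: \<phi>_def)
  qed
  show "\<phi> holomorphic_on ball 0 t"
    by (rule power_series_holomorphic[where a = c]) (use series in auto)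
  have "\<forall>\<^sub>F z in nhds 0. z \<in> ball (0::complex) t"
    using t by (intro eventually_nhds_in_open) auto
  then have "\<phi> has_fps_expansion Abs_fps c"
    by (intro has_fps_expansionI) (auto elim!: eventually_mono intro: series)
  from fps_nth_fps_expansion[OF this, of k] show "(deriv ^^ k) \<phi> 0 = of_real (expectation (\<lambda>\<omega>. S \<omega> ^ k))"
    by (simp add: c_def)
qed

subsection \<open>Perturbation of the transfer operator\<close>

context function_banach_space
begin

text \<open>Induction on T^(n+1) - S^(n+1) = (T - S) T^n + S (T^n - S^n); \<open>1 \<le> K\<close>
  lets \<open>K ^ n\<close> be absorbed into \<open>K ^ Suc n\<close>.\<close>

lemma funpow_perturbation:
  assumes S: "bounded_op B nrm S" and T: "bounded_op B nrm T"
    and K: "1 \<le> K" "\<And>g. g \<in> B \<Longrightarrow> nrm (S g) \<le> K * nrm g" "\<And>g. g \<in> B \<Longrightarrow> nrm (T g) \<le> K * nrm g"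
    and \<eta>: "0 \<le> \<eta>" "\<And>g. g \<in> B \<Longrightarrow> nrm (\<lambda>x. T g x - S g x) \<le> \<eta> * nrm g" and g: "g \<in> B"
  shows "nrm (\<lambda>x. (T ^^ n) g x - (S ^^ n) g x) \<le> real n * K ^ n * \<eta> * nrm g"
proof (induction n)
  case (Suc n)
  note Sm = bounded_op_mem[OF S] and Tm = bounded_op_mem[OF T]
  have Tn: "(T ^^ n) g \<in> B" and Sn: "(S ^^ n) g \<in> B"
    by (rule bounded_op_mem[OF bounded_op_funpow[OF T] g] bounded_op_mem[OF bounded_op_funpow[OF S] g])+
  have "nrm (\<lambda>x. T ((T ^^ n) g) x - S ((T ^^ n) g) x) \<le> \<eta> * (K ^ n * nrm g)"
    using order_trans[OF \<eta>(2)[OF Tn] mult_left_mono[OF funpow_bound[OF Tm K(3) _ g, of n] \<eta>(1)]] K(1) by simp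
  also have "\<dots> \<le> K ^ Suc n * \<eta> * nrm g"
  proof -
    have "K ^ n \<le> K ^ Suc n"
      using K(1) by (intro power_increasing) auto
    from mult_right_mono[OF this mult_nonneg_nonneg[OF \<eta>(1) nrm_nonneg[OF g]]] show ?thesis
      by (simp add: mult_ac)
  qed
  finally have 1: "nrm (\<lambda>x. T ((T ^^ n) g) x - S ((T ^^ n) g) x) \<le> K ^ Suc n * \<eta> * nrm g" .
  have "nrm (\<lambda>x. S ((T ^^ n) g) x - S ((S ^^ n) g) x) \<le> K * nrm (\<lambda>x. (T ^^ n) g x - (S ^^ n) g x)"
    using K(2)[OF diff_mem[OF Tn Sn]] by (simp add: bounded_op_diff[OF S Tn Sn])
  also have "\<dots> \<le> K * (real n * K ^ n * \<eta> * nrm g)"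
    using K(1) Suc by (intro mult_left_mono) auto
  finally have 2: "nrm (\<lambda>x. S ((T ^^ n) g) x - S ((S ^^ n) g) x) \<le> real n * K ^ Suc n * \<eta> * nrm g"
    by (simp add: mult_ac)
  have "nrm (\<lambda>x. (T ^^ Suc n) g x - (S ^^ Suc n) g x)
      \<le> nrm (\<lambda>x. T ((T ^^ n) g) x - S ((T ^^ n) g) x) + nrm (\<lambda>x. S ((T ^^ n) g) x - S ((S ^^ n) g) x)"
    using nrm_diff_triangle[OF Tm[OF Tn] Sm[OF Tn] Sm[OF Sn]] by simp
  with 1 2 show ?case
    by (simp add: algebra_simps)
qed simp

text \<open>Write \<open>k = i + q * j\<close> with \<open>i < q\<close>: the \<open>j\<close> full
  blocks halve the norm each, the rest costs at most \<open>K ^ q\<close>. The choice of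
  \<open>\<theta>\<close> turns the halvings into the rate \<open>\<theta> ^ (3 * k)\<close> that
  the renewal argument requires, up to a factor 2.\<close>

lemma funpow_geometric_decay:
  assumes T: "bounded_op B nrm T" and K: "1 \<le> K" "\<And>g. g \<in> B \<Longrightarrow> nrm (T g) \<le> K * nrm g"
    and half: "\<And>g. g \<in> B \<Longrightarrow> nrm ((T ^^ q) g) \<le> 1 / 2 * nrm g"
    and \<theta>: "0 < \<theta>" "\<theta> < 1" "\<theta> ^ (3 * q) = 1 / 2" and g: "g \<in> B"
  shows "nrm ((T ^^ k) g) \<le> 2 * K ^ q * \<theta> ^ (3 * k) * nrm g"
proof -
  have q: "q > 0"
    using \<theta>(3) by (cases q) auto
  define i j where "i = k mod q" and "j = k div q"
  have i: "i < q" and k: "k = i + q * j"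
    using q by (auto simp: i_def j_def)
  have Tm: "(T ^^ n) g \<in> B" if "g \<in> B" for n g
    by (rule bounded_op_mem[OF bounded_op_funpow[OF T] that])
  have "nrm ((T ^^ k) g) \<le> K ^ i * nrm (((T ^^ q) ^^ j) g)"
    unfolding k funpow_add funpow_mult[symmetric] o_apply
    using K Tm[OF g, of "q * j"] bounded_op_mem[OF T] by (intro funpow_bound) (auto simp: funpow_mult)
  also have "\<dots> \<le> K ^ q * ((1 / 2) ^ j * nrm g)"
    using K(1) i funpow_bound[of "T ^^ q" "1 / 2" g j] Tm half g nrm_nonneg[OF Tm[OF g, of "q * j"]]
    by (intro mult_mono power_increasing) (auto simp: funpow_mult)
  also have "(1 / 2) ^ j \<le> 2 * \<theta> ^ (3 * k)"
  proof -
    have "\<theta> ^ (3 * k) = \<theta> ^ (3 * i) * (1 / 2) ^ j"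
      unfolding \<theta>(3)[symmetric] power_mult[symmetric] power_add[symmetric] k by (simp add: algebra_simps)
    moreover have "1 / 2 \<le> \<theta> ^ (3 * i)"
      unfolding \<theta>(3)[symmetric] using \<theta> i by (intro power_decreasing) auto
    ultimately show ?thesis
      using mult_right_mono[of "1 / 2" "\<theta> ^ (3 * i)" "(1 / 2) ^ j"] by simp
  qed
  finally show ?thesis
    using K(1) nrm_nonneg[OF g] by (simp add: mult_left_mono mult_right_mono mult_ac)
qed

text \<open>Near \<open>z0\<close> the difference quotient is within operator norm 1 of the
  derivative, hence bounded by 1 plus a bound for the derivative.\<close>

lemma op_analytic_lipschitz:
  assumes T: "op_analytic_on B nrm T V" and V: "open V" "z0 \<in> V"
  obtains r M where "r > 0" "M > 0" "ball z0 r \<subseteq> V"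
    "\<And>z g. z \<in> ball z0 r \<Longrightarrow> g \<in> B \<Longrightarrow> nrm (\<lambda>x. T z g x - T z0 g x) \<le> cmod (z - z0) * M * nrm g"
proof -
  have Tz: "bounded_op B nrm (T z)" if "z \<in> V" for z
    using T that by (simp add: op_analytic_on_def)
  obtain D where D: "bounded_op B nrm D"
      "((\<lambda>w. op_norm B nrm (\<lambda>g x. (T w g x - T z0 g x) / (w - z0) - D g x)) \<longlongrightarrow> 0) (at z0)"
    using T V(2) unfolding op_analytic_on_def by blast
  obtain K where K: "K > 0" "\<And>g. g \<in> B \<Longrightarrow> nrm (D g) \<le> K * nrm g"
    using bounded_op_bound[OF D(1)] by blast
  have "\<forall>\<^sub>F w in at z0. op_norm B nrm (\<lambda>g x. (T w g x - T z0 g x) / (w - z0) - D g x) < 1"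
    by (rule order_tendstoD(2)[OF D(2)]) simp
  then obtain d where d: "d > 0" "\<And>w. w \<noteq> z0 \<Longrightarrow> dist w z0 < d \<Longrightarrow>
      op_norm B nrm (\<lambda>g x. (T w g x - T z0 g x) / (w - z0) - D g x) < 1"
    by (auto simp: eventually_at)
  obtain e where e: "e > 0" "ball z0 e \<subseteq> V"
    using V open_contains_ball by blast
  show ?thesis
  proof (rule that[of "min d e" "1 + K"])
    fix z g assume z: "z \<in> ball z0 (min d e)" and g: "g \<in> B"
    show "nrm (\<lambda>x. T z g x - T z0 g x) \<le> cmod (z - z0) * (1 + K) * nrm g"
    proof (cases "z = z0")
      case False
      define R where "R g x = (T z g x - T z0 g x) / (z - z0) - D g x" for g x
      have zV: "z \<in> V"
        using z e(2) by auto
      \<comment> \<open>Written as a linear combination, \<open>R\<close> is seen to be a bounded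
        operator, as needed before \<open>op_norm\<close> can bound its values.\<close>
      have "R = (\<lambda>g x. 1 * ((1 / (z - z0)) * T z g x + (- 1 / (z - z0)) * T z0 g x) + (-1) * D g x)"
        by (auto simp: R_def fun_eq_iff diff_divide_distrib)
      then have R: "bounded_op B nrm R"
        by (simp only:) (intro bounded_op_lincomb Tz zV V D)
      have "op_norm B nrm R \<le> 1"
        using d(2)[of z] z False by (simp add: R_def[abs_def] dist_commute)
      then have "nrm (R g) \<le> 1 * nrm g"
        using order_trans[OF op_norm_bound[OF R g] mult_right_mono[OF _ nrm_nonneg[OF g]]] by blast
      moreover have "nrm (\<lambda>x. R g x + D g x) \<le> nrm (R g) + nrm (D g)"
        by (intro nrm_triangle bounded_op_mem[OF R g] bounded_op_mem[OF D(1) g])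
      ultimately have "nrm (\<lambda>x. R g x + D g x) \<le> (1 + K) * nrm g"
        using K(2)[OF g] by (simp add: algebra_simps)
      moreover have "(\<lambda>x. T z g x - T z0 g x) = (\<lambda>x. (z - z0) * (R g x + D g x))"
        using False by (auto simp: R_def)
      ultimately show ?thesis
        using nrm_scale[OF add_mem[OF bounded_op_mem[OF R g] bounded_op_mem[OF D(1) g]], of "z - z0"]
          mult_left_mono[of _ _ "cmod (z - z0)"] by (simp add: mult.assoc)
    qed simp
  qed (use d e K in auto)
qed

end

section \<open>The kernel of \<open>mu\<close>, the deflated operator and the renewal
  equation\<close>

context transfer_operator_setting
begin

lemma mu_add: "g \<in> B \<Longrightarrow> h \<in> B \<Longrightarrow> (\<integral>x. g x + h x \<partial>mu) = (\<integral>x. g x \<partial>mu) + (\<integral>x. h x \<partial>mu)"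
  by (intro Bochner_Integration.integral_add B_integrable)

lemma mu_diff: "g \<in> B \<Longrightarrow> h \<in> B \<Longrightarrow> (\<integral>x. g x - h x \<partial>mu) = (\<integral>x. g x \<partial>mu) - (\<integral>x. h x \<partial>mu)"
  by (intro Bochner_Integration.integral_diff B_integrable)

lemma mu_bound: "g \<in> B \<Longrightarrow> cmod (\<integral>x. g x \<partial>mu) \<le> nrm g"
  using order_trans[OF integral_norm_bound nrm_ge_L1] .

lemma mu_kernel_closed:
  assumes s: "\<And>n. s n \<in> B" "\<And>n. (\<integral>x. s n x \<partial>mu) = 0" and g: "g \<in> B"
    and lim: "(\<lambda>n. nrm (\<lambda>x. s n x - g x)) \<longlonglongrightarrow> 0"
  shows "(\<integral>x. g x \<partial>mu) = 0"
proof -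
  have "cmod (\<integral>x. g x \<partial>mu) \<le> nrm (\<lambda>x. s n x - g x)" for n
    using mu_bound[OF diff_mem[OF s(1) g], of n] by (simp add: mu_diff s g)
  then have "cmod (\<integral>x. g x \<partial>mu) \<le> 0"
    by (intro LIMSEQ_le_const[OF lim]) auto
  then show ?thesis by simp
qed

text \<open>The kernel is closed since the functional is continuous; as a Banach space of its own it
  inherits the power estimates proved above for operators on \<open>B\<close>.\<close>

lemma mu_kernel_banach: "function_banach_space {g \<in> B. (\<integral>x. g x \<partial>mu) = 0} nrm"
proof
  fix s :: "nat \<Rightarrow> 'x \<Rightarrow> complex"
  assume s: "\<And>n. s n \<in> {g \<in> B. (\<integral>x. g x \<partial>mu) = 0}"
    and cauchy: "\<And>e. e > 0 \<Longrightarrow> \<exists>K. \<forall>m\<ge>K. \<forall>n\<ge>K. nrm (\<lambda>x. s m x - s n x) < e"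
  have sB: "s n \<in> B" for n
    using s[of n] by simp
  obtain g where g: "g \<in> B" "(\<lambda>n. nrm (\<lambda>x. s n x - g x)) \<longlonglongrightarrow> 0"
    using complete[OF sB cauchy] by blast
  with s show "\<exists>g\<in>{g \<in> B. (\<integral>x. g x \<partial>mu) = 0}. (\<lambda>n. nrm (\<lambda>x. s n x - g x)) \<longlonglongrightarrow> 0"
    using mu_kernel_closed[of s g] by auto
qed (auto simp: zero_mem add_mem scale_mem mu_add nrm_nonneg nrm_eq_0 nrm_triangle nrm_scale)

text \<open>An eigenvalue of modulus at least 1 on the kernel has modulus exactly 1 by the spectral
  radius, so its eigenfunction is a multiple of \<open>h0\<close>; as \<open>h0\<close> has integral
  1, the multiple is zero.\<close>

lemma funpow_small_on_mu_kernel: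
  assumes quasi: "quasi_compact B nrm L" and radius: "op_spectral_radius B nrm L = 1"
    and unique: "\<forall>l g. cmod l = 1 \<longrightarrow> eigenfunction B L l g \<longrightarrow> (\<exists>c. g = (\<lambda>x. c * h0 x))"
    and e: "0 < e"
  shows "\<exists>n\<ge>1. \<forall>v\<in>B. (\<integral>x. v x \<partial>mu) = 0 \<longrightarrow> nrm ((L ^^ n) v) \<le> e * nrm v"
proof -
  define E where "E = {g \<in> B. (\<integral>x. g x \<partial>mu) = 0}"
  interpret ker: function_banach_space E nrm
    unfolding E_def by (rule mu_kernel_banach)
  obtain m K where K: "compact_op B nrm K" and less: "op_norm B nrm (\<lambda>g x. (L ^^ m) g x - K g x) < 1"
    using quasi by (auto simp: quasi_compact_def radius)
  have Kop: "bounded_op B nrm K"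
    using K by (simp add: compact_op_def)
  have R: "bounded_op B nrm (\<lambda>g x. (L ^^ m) g x - K g x)"
    using bounded_op_lincomb[OF bounded_op_funpow[OF L_bounded, of m] Kop, of 1 "-1"] by simp
  have no_eigen: "g = (\<lambda>x. 0)" if g: "g \<in> E" and l: "1 \<le> cmod l" and Lg: "L g = (\<lambda>x. l * g x)" for l g
  proof (rule ccontr)
    assume "g \<noteq> (\<lambda>x. 0)"
    then have eig: "eigenfunction B L l g"
      using g Lg by (simp add: eigenfunction_def E_def)
    have "cmod l = 1"
      using eigenvalue_le_op_spectral_radius[OF L_bounded eig] l radius by simp
    then obtain c where c: "g = (\<lambda>x. c * h0 x)"
      using unique eig by blast
    have "c = 0"
      using g by (simp add: E_def c h0_mu)
    with c \<open>g \<noteq> (\<lambda>x. 0)\<close> show False by simp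
  qed
  \<comment> \<open>The operator \<open>K\<close> need not map \<open>E\<close> to itself, so
    compactness is used on all of \<open>B\<close> and only the test vectors are taken from
    \<open>E\<close>.\<close>
  have "\<exists>c>0. \<forall>w v. cmod w \<le> 1 \<longrightarrow> v \<in> E \<longrightarrow> c * nrm v \<le> nrm (\<lambda>x. v x - w * L v x)"
  proof (rule bounded_below_if_no_eigenvalue[OF L_bounded K R op_norm_bound[OF R] less])
    show "g \<in> E" if "\<And>n. s n \<in> E" "g \<in> B" "(\<lambda>n. nrm (\<lambda>x. s n x - g x)) \<longlonglongrightarrow> 0" for s g
      using that mu_kernel_closed[of s g] by (simp add: E_def)
  qed (use no_eigen in \<open>auto simp: E_def scale_mem\<close>)
  then obtain c where c: "c > 0" "\<And>w v. cmod w \<le> 1 \<Longrightarrow> v \<in> E \<Longrightarrow> c * nrm v \<le> nrm (\<lambda>x. v x - w * L v x)"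
    by blast
  obtain k where k: "\<And>g. g \<in> B \<Longrightarrow> nrm (L g) \<le> k * nrm g"
    using bounded_op_bound[OF L_bounded] by blast
  have "bounded_op E nrm L"
    by (rule ker.bounded_opI[of _ k])
      (auto simp: E_def bounded_op_mem[OF L_bounded] bounded_op_add[OF L_bounded]
        bounded_op_scale[OF L_bounded] L_mu k)
  from ker.funpow_small_if_bounded_below[OF this c e] show ?thesis
    by (auto simp: E_def)
qed

lemma deflated_bounded_op:
  assumes T: "bounded_op B nrm T"
  shows "bounded_op B nrm (\<lambda>g x. T g x - (\<integral>y. g y \<partial>mu) * h0 x)"
proof -
  have "bounded_op B nrm (\<lambda>g x. (\<integral>y. g y \<partial>mu) * h0 x)"
  proof (rule bounded_opI[of _ "nrm h0"])
    fix g assume g: "g \<in> B"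
    show "(\<lambda>x. (\<integral>y. g y \<partial>mu) * h0 x) \<in> B"
      by (intro scale_mem h0_mem)
    show "nrm (\<lambda>x. (\<integral>y. g y \<partial>mu) * h0 x) \<le> nrm h0 * nrm g"
      using mult_right_mono[OF mu_bound[OF g] nrm_nonneg[OF h0_mem]]
      unfolding nrm_scale[OF h0_mem] by (simp add: mult.commute)
  qed (auto simp: mu_add algebra_simps)
  from bounded_op_lincomb[OF T this, of 1 "-1"] show ?thesis
    by simp
qed

text \<open>Here T = N + h0 \<otimes> mu, so T^(n+1) h0 is N T^n h0 plus \<open>A (Suc n)\<close>
  times \<open>h0\<close>. The second term becomes the summand \<open>k = 0\<close> and all others
  shift by one; integrating the first identity gives the second.\<close>

lemma funpow_renewal:
  assumes T: "bounded_op B nrm T"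
  defines "N \<equiv> \<lambda>g x. T g x - (\<integral>y. g y \<partial>mu) * h0 x"
    and "A \<equiv> \<lambda>n. if n = 0 then 1 else \<integral>x. (T ^^ (n - 1)) h0 x \<partial>mu"
  shows "(T ^^ n) h0 = (\<lambda>x. \<Sum>k\<le>n. A (n - k) * (N ^^ k) h0 x)"
    and "A (Suc n) = (\<Sum>k\<le>n. (\<integral>x. (N ^^ k) h0 x \<partial>mu) * A (n - k))"
proof -
  have N: "bounded_op B nrm N"
    unfolding N_def by (rule deflated_bounded_op[OF T])
  have Nk: "(N ^^ k) h0 \<in> B" for k
    by (rule bounded_op_mem[OF bounded_op_funpow[OF N] h0_mem])
  show *: "(T ^^ n) h0 = (\<lambda>x. \<Sum>k\<le>n. A (n - k) * (N ^^ k) h0 x)"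
  proof (induction n)
    case (Suc n)
    have "(T ^^ Suc n) h0 = (\<lambda>x. N ((T ^^ n) h0) x + A (Suc n) * h0 x)"
      by (simp add: N_def A_def)
    also have "N ((T ^^ n) h0) = (\<lambda>x. \<Sum>k\<le>n. A (n - k) * (N ^^ Suc k) h0 x)"
      unfolding Suc using bounded_op_sum[OF N, of "{..n}" "\<lambda>k. (N ^^ k) h0" "\<lambda>k. A (n - k)"] Nk by simp
    finally show ?case
      by (auto simp: sum.atMost_Suc_shift simp del: sum.atMost_Suc)
  qed (simp add: A_def)
  have "A (Suc n) = (\<integral>x. (\<Sum>k\<le>n. A (n - k) * (N ^^ k) h0 x) \<partial>mu)"
    by (simp add: A_def *)
  also have "\<dots> = (\<Sum>k\<le>n. (\<integral>x. (N ^^ k) h0 x \<partial>mu) * A (n - k))"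
    by (subst Bochner_Integration.integral_sum) (auto intro!: sum.cong B_integrable scale_mem Nk)
  finally show "A (Suc n) = (\<Sum>k\<le>n. (\<integral>x. (N ^^ k) h0 x \<partial>mu) * A (n - k))" .
qed

text \<open>Subtracting the \<open>h0\<close> component projects \<open>v\<close> to
  \<open>v'\<close> in the kernel of \<open>mu\<close>. There N and L agree, and N v = L v', so the
  n-th powers agree for \<open>n \<ge> 1\<close>. The projection has norm at most
  \<open>1 + nrm h0\<close>, by which \<open>e\<close> is divided beforehand.\<close>

lemma deflated_funpow_small:
  assumes quasi: "quasi_compact B nrm L" and radius: "op_spectral_radius B nrm L = 1"
    and unique: "\<forall>l g. cmod l = 1 \<longrightarrow> eigenfunction B L l g \<longrightarrow> (\<exists>c. g = (\<lambda>x. c * h0 x))"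
    and e: "0 < e"
  shows "\<exists>n\<ge>1. \<forall>v\<in>B. nrm (((\<lambda>g x. L g x - (\<integral>y. g y \<partial>mu) * h0 x) ^^ n) v) \<le> e * nrm v"
proof -
  define N where "N = (\<lambda>g x. L g x - (\<integral>y. g y \<partial>mu) * h0 x)"
  have h: "1 + nrm h0 > 0"
    using nrm_nonneg[OF h0_mem] by simp
  obtain n where n: "n \<ge> 1"
      "\<And>v. v \<in> B \<Longrightarrow> (\<integral>x. v x \<partial>mu) = 0 \<Longrightarrow> nrm ((L ^^ n) v) \<le> e / (1 + nrm h0) * nrm v"
    using funpow_small_on_mu_kernel[OF quasi radius unique divide_pos_pos[OF e h]] by blast
  have "nrm ((N ^^ n) v) \<le> e * nrm v" if v: "v \<in> B" for v
  proof -
    define v' where "v' = (\<lambda>x. v x - (\<integral>y. v y \<partial>mu) * h0 x)"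
    have v': "v' \<in> B"
      unfolding v'_def by (intro diff_mem scale_mem v h0_mem)
    have mu_v': "(\<integral>x. v' x \<partial>mu) = 0"
      unfolding v'_def by (subst mu_diff) (auto simp: v scale_mem h0_mem h0_mu)
    have Lv': "L v' = N v"
      unfolding v'_def bounded_op_diff[OF L_bounded v scale_mem[OF h0_mem]]
        bounded_op_scale[OF L_bounded h0_mem] L_h0 N_def ..
    have L_pow: "(L ^^ k) v' \<in> B \<and> (\<integral>x. (L ^^ k) v' x \<partial>mu) = 0" for k
      by (induction k) (auto simp: v' mu_v' L_mu bounded_op_mem[OF L_bounded])
    have "(N ^^ Suc k) v = (L ^^ Suc k) v'" for k
    proof (induction k)
      case (Suc k)
      have "(N ^^ Suc (Suc k)) v = N ((L ^^ Suc k) v')"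
        using Suc by simp
      also have "\<dots> = (L ^^ Suc (Suc k)) v'"
        using L_pow[of "Suc k"] by (simp add: N_def)
      finally show ?case .
    qed (simp add: Lv')
    then have "(N ^^ n) v = (L ^^ n) v'"
      using n(1) by (cases n) auto
    then have "nrm ((N ^^ n) v) \<le> e / (1 + nrm h0) * nrm v'"
      using n(2)[OF v' mu_v'] by simp
    also have "\<dots> \<le> e / (1 + nrm h0) * ((1 + nrm h0) * nrm v)"
    proof (rule mult_left_mono)
      have "nrm v' \<le> nrm v + cmod (\<integral>y. v y \<partial>mu) * nrm h0"
        unfolding v'_def using nrm_diff_le[OF v scale_mem[OF h0_mem]] by (simp add: nrm_scale[OF h0_mem])
      also have "\<dots> \<le> nrm v + nrm v * nrm h0"
        by (intro add_left_mono mult_right_mono mu_bound v nrm_nonneg h0_mem)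
      finally show "nrm v' \<le> (1 + nrm h0) * nrm v"
        by (simp add: algebra_simps)
    qed (use e h in auto)
    finally show ?thesis
      using h by simp
  qed
  with n(1) show ?thesis
    unfolding N_def by blast
qed

text \<open>
  The coefficients \<open>\<mu>(N\<^sup>k h\<^sub>0)\<close>, \<open>k \<ge> 1\<close>, vanish for \<open>T = L\<close>, since then \<open>N h\<^sub>0 = L h\<^sub>0 - h\<^sub>0 = 0\<close>.
\<close>

lemma renewal_coefficients_small:
  assumes quasi: "quasi_compact B nrm L" and radius: "op_spectral_radius B nrm L = 1"
    and unique: "\<forall>l g. cmod l = 1 \<longrightarrow> eigenfunction B L l g \<longrightarrow> (\<exists>c. g = (\<lambda>x. c * h0 x))"
  obtains \<theta> \<eta> where "0 < \<theta>" "\<theta> < 1" "0 < \<eta>"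
    "\<And>T k. bounded_op B nrm T \<Longrightarrow> (\<And>g. g \<in> B \<Longrightarrow> nrm (\<lambda>x. T g x - L g x) \<le> \<eta> * nrm g) \<Longrightarrow> k \<ge> 1 \<Longrightarrow>
      cmod (\<integral>x. ((\<lambda>g x. T g x - (\<integral>y. g y \<partial>mu) * h0 x) ^^ k) h0 x \<partial>mu) \<le> (1 - \<theta>)\<^sup>2 / 2 * \<theta> ^ (3 * k)"
proof -
  define N where "N T = (\<lambda>g x. T g x - (\<integral>y. g y \<partial>mu) * h0 x)" for T :: "('x \<Rightarrow> complex) \<Rightarrow> ('x \<Rightarrow> complex)"
  have N_op: "bounded_op B nrm (N T)" if "bounded_op B nrm T" for T
    unfolding N_def by (rule deflated_bounded_op[OF that])
  \<comment> \<open>The value 1/4 leaves room for another 1/4 from the perturbation, so that the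
    q-th power still halves norms.\<close>
  obtain q where q: "q \<ge> 1" "\<And>v. v \<in> B \<Longrightarrow> nrm ((N L ^^ q) v) \<le> 1 / 4 * nrm v"
    using deflated_funpow_small[OF quasi radius unique, of "1 / 4"] unfolding N_def by auto
  obtain K0 where K0: "K0 > 0" "\<And>g. g \<in> B \<Longrightarrow> nrm (N L g) \<le> K0 * nrm g"
    using bounded_op_bound[OF N_op[OF L_bounded]] by blast
  define K where "K = K0 + 1"
  have K: "K \<ge> 1" using K0 by (simp add: K_def)
  define \<theta> where "\<theta> = root (3 * q) (1 / 2)"
  have \<theta>: "0 < \<theta>" "\<theta> < 1" "\<theta> ^ (3 * q) = 1 / 2"
    using q(1) by (auto simp: \<theta>_def)
  \<comment> \<open>All constants in front of \<open>\<eta> * \<theta> ^ (3 * k)\<close>: the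
    division by \<open>\<theta> ^ 3\<close> arises because one of the \<open>k\<close> factors is
    spent on \<open>h0\<close>, and the added 1 makes \<open>H\<close> visibly positive.\<close>
  define H where "H = 2 * K ^ q * (nrm h0 + 1) / \<theta> ^ 3"
  have H: "H > 0"
    using K \<theta> nrm_nonneg[OF h0_mem] by (auto simp: H_def intro!: divide_pos_pos mult_pos_pos)
  \<comment> \<open>The three entries let \<open>K = K0 + 1\<close> bound the perturbed operator as
    well, keep its q-th power within 1/4 of the original one, and bring the coefficients down to the
    size demanded by \<open>renewal_ratio\<close>.\<close>
  define \<eta> where "\<eta> = min 1 (min (1 / (4 * real q * K ^ q)) ((1 - \<theta>)\<^sup>2 / 2 / H))"
  have \<eta>: "0 < \<eta>" "\<eta> \<le> 1"
    using K q(1) \<theta> H by (auto simp: \<eta>_def)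
  have \<eta>q: "real q * K ^ q * \<eta> \<le> 1 / 4"
  proof -
    have "\<eta> \<le> 1 / (4 * real q * K ^ q)" by (simp add: \<eta>_def)
    then show ?thesis
      using K q(1) by (simp add: field_simps)
  qed
  have \<eta>H: "H * \<eta> \<le> (1 - \<theta>)\<^sup>2 / 2"
  proof -
    have "\<eta> \<le> (1 - \<theta>)\<^sup>2 / 2 / H" by (simp add: \<eta>_def)
    then show ?thesis
      using H by (simp add: field_simps)
  qed
  have bound: "cmod (\<integral>x. (N T ^^ k) h0 x \<partial>mu) \<le> (1 - \<theta>)\<^sup>2 / 2 * \<theta> ^ (3 * k)"
    if T: "bounded_op B nrm T" and near: "\<And>g. g \<in> B \<Longrightarrow> nrm (\<lambda>x. T g x - L g x) \<le> \<eta> * nrm g"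
      and k: "k \<ge> 1" for T k
  proof -
    note Nm = bounded_op_mem[OF N_op[OF T]] and N0m = bounded_op_mem[OF N_op[OF L_bounded]]
    have N_near: "nrm (\<lambda>x. N T g x - N L g x) \<le> \<eta> * nrm g" if "g \<in> B" for g
      using near[OF that] by (simp add: N_def)
    have KL: "nrm (N L g) \<le> K * nrm g" if "g \<in> B" for g
      using K0(2)[OF that] nrm_nonneg[OF that] by (simp add: K_def algebra_simps)
    have KT: "nrm (N T g) \<le> K * nrm g" if g: "g \<in> B" for g
      using nrm_le_diff[OF Nm[OF g] N0m[OF g]] N_near[OF g] K0(2)[OF g]
        mult_right_mono[OF \<eta>(2) nrm_nonneg[OF g]] by (simp add: K_def algebra_simps)
    have half: "nrm ((N T ^^ q) g) \<le> 1 / 2 * nrm g" if g: "g \<in> B" for g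
    proof -
      have "nrm (\<lambda>x. (N T ^^ q) g x - (N L ^^ q) g x) \<le> real q * K ^ q * \<eta> * nrm g"
        by (rule funpow_perturbation[OF N_op[OF L_bounded] N_op[OF T] K KL KT _ N_near g]) (use \<eta> in auto)
      also have "\<dots> \<le> 1 / 4 * nrm g"
        by (rule mult_right_mono[OF \<eta>q nrm_nonneg[OF g]])
      finally show ?thesis
        using nrm_le_diff[OF bounded_op_mem[OF bounded_op_funpow[OF N_op[OF T], of q] g]
            bounded_op_mem[OF bounded_op_funpow[OF N_op[OF L_bounded], of q] g]] q(2)[OF g] by simp
    qed
    obtain j where j: "k = Suc j"
      using k by (cases k) auto
    \<comment> \<open>As \<open>h0\<close> has integral 1 and is fixed by \<open>L\<close>, N T h0
      is T h0 - L h0; this is where the factor \<open>\<eta>\<close> comes from.\<close>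
    have Nh0: "nrm (N T h0) \<le> \<eta> * nrm h0"
      using near[OF h0_mem] by (simp add: N_def h0_mu L_h0)
    have "cmod (\<integral>x. (N T ^^ k) h0 x \<partial>mu) \<le> nrm ((N T ^^ k) h0)"
      by (rule mu_bound[OF bounded_op_mem[OF bounded_op_funpow[OF N_op[OF T]] h0_mem]])
    also have "\<dots> = nrm ((N T ^^ j) (N T h0))"
      unfolding j funpow_Suc_right by simp
    also have "\<dots> \<le> 2 * K ^ q * \<theta> ^ (3 * j) * nrm (N T h0)"
      by (rule funpow_geometric_decay[OF N_op[OF T] K KT half \<theta> Nm[OF h0_mem]])
    also have "\<dots> \<le> 2 * K ^ q * \<theta> ^ (3 * j) * (\<eta> * (nrm h0 + 1))"
      using Nh0 K \<theta> \<eta> by (intro mult_left_mono) (auto simp: algebra_simps intro: order_trans)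
    also have "\<dots> = H * \<eta> * \<theta> ^ (3 * k)"
      using \<theta> by (simp add: H_def j power_add field_simps)
    also have "\<dots> \<le> (1 - \<theta>)\<^sup>2 / 2 * \<theta> ^ (3 * k)"
      using \<theta> by (intro mult_right_mono \<eta>H) auto
    finally show ?thesis .
  qed
  show ?thesis
    by (rule that[OF \<theta>(1,2) \<eta>(1)]) (use bound in \<open>auto simp: N_def\<close>)
qed

text \<open>The product formula with every factor equal to exp(z f). The setting covers only
  \<open>n \<ge> 1\<close>; for \<open>n = 0\<close> both sides are 1.\<close>

lemma twisted_expectation:
  assumes e: "(\<lambda>x. exp (z * complex_of_real (f x))) \<in> B"
  shows "integrable P (\<lambda>\<omega>. exp (z * complex_of_real (partial_sum f U n \<omega>)))"
    and "P.expectation (\<lambda>\<omega>. exp (z * complex_of_real (partial_sum f U n \<omega>)))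
      = (\<integral>x. (twisted_op L f z ^^ n) h0 x \<partial>mu)"
proof -
  have chain: "op_chain L (\<lambda>_ x. exp (z * complex_of_real (f x))) h0 n = (twisted_op L f z ^^ n) h0"
    by (induction n) (auto simp: twisted_op_def)
  have prod: "exp (z * complex_of_real (partial_sum f U n \<omega>)) = (\<Prod>j=1..n. exp (z * complex_of_real (f (U j \<omega>))))" for \<omega>
    by (simp add: partial_sum_def sum_distrib_left exp_sum)
  show "integrable P (\<lambda>\<omega>. exp (z * complex_of_real (partial_sum f U n \<omega>)))"
    using U_integrable[of n "\<lambda>_ x. exp (z * complex_of_real (f x))"] e
    unfolding prod by (cases "n = 0") auto
  show "P.expectation (\<lambda>\<omega>. exp (z * complex_of_real (partial_sum f U n \<omega>)))
      = (\<integral>x. (twisted_op L f z ^^ n) h0 x \<partial>mu)"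
    using U_expectation[of n "\<lambda>_ x. exp (z * complex_of_real (f x))"] e
    unfolding prod chain by (cases "n = 0") (auto simp: h0_mu P.prob_space)
qed

lemma partial_sum_measurable:
  assumes "(\<lambda>x. complex_of_real (f x)) \<in> B"
  shows "partial_sum f U n \<in> borel_measurable P"
proof -
  have "(\<lambda>x. Re (complex_of_real (f x))) \<in> borel_measurable mu"
    using borel_measurable_integrable[OF B_integrable[OF assms]] by measurable
  then have [measurable]: "f \<in> borel_measurable mu"
    by simp
  have "(\<lambda>\<omega>. f (U j \<omega>)) \<in> borel_measurable P" if "j \<in> {1..n}" for j
    using U_measurable[of j] that by (auto intro: measurable_compose)
  then have "(\<lambda>\<omega>. \<Sum>j=1..n. f (U j \<omega>)) \<in> borel_measurable P"
    by (rule borel_measurable_sum)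
  then show ?thesis
    by (simp add: partial_sum_def[abs_def])
qed

end

theorem proposition26:
  fixes B :: "('x \<Rightarrow> complex) set" and nrm :: "('x \<Rightarrow> complex) \<Rightarrow> real"
    and mu :: "'x measure" and P :: "'w measure"
    and L :: "('x \<Rightarrow> complex) \<Rightarrow> ('x \<Rightarrow> complex)" and h0 :: "'x \<Rightarrow> complex"
    and U :: "nat \<Rightarrow> 'w \<Rightarrow> 'x" and f :: "'x \<Rightarrow> real" and \<sigma> :: real and V :: "complex set"
  assumes setting: "transfer_operator_setting B nrm mu P L h0 U"
    and f_mem: "(\<lambda>x. complex_of_real (f x)) \<in> B"
    and f_mean: "(\<integral>x. f x \<partial>mu) = 0"
    and variance_limit:
      "(\<lambda>n. prob_space.variance P (partial_sum f U n) / real n) \<longlonglongrightarrow> \<sigma>\<^sup>2"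
    and variance_pos: "\<sigma>\<^sup>2 > 0"
    and V_nhd: "open V" "0 \<in> V"
    and twisted_well_defined:
      "\<And>z g. z \<in> V \<Longrightarrow> g \<in> B \<Longrightarrow> (\<lambda>x. exp (z * complex_of_real (f x)) * g x) \<in> B"
    and twisted_analytic: "op_analytic_on B nrm (twisted_op L f) V"
    and quasi: "quasi_compact B nrm L"
    and radius: "op_spectral_radius B nrm L = 1"
    and unique_eigenfunction:
      "\<And>l g. cmod l = 1 \<Longrightarrow> eigenfunction B L l g \<Longrightarrow> \<exists>c. g = (\<lambda>x. c * h0 x)"
  shows "\<exists>(W :: complex set) (Pi :: complex \<Rightarrow> complex) (u :: complex \<Rightarrow> complex)
           (dn :: nat \<Rightarrow> complex \<Rightarrow> complex) (C :: real) (\<delta> :: real).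
    open W \<and> 0 \<in> W \<and>
    Pi analytic_on W \<and> u analytic_on W \<and> (\<forall>n\<ge>1. dn n analytic_on W) \<and>
    C > 0 \<and> 0 < \<delta> \<and> \<delta> < 1 \<and>
    Pi 0 = 0 \<and> (deriv ^^ 2) Pi 0 \<in> \<real> \<and> Re ((deriv ^^ 2) Pi 0) > 0 \<and> u 0 = 1 \<and>
    (\<forall>n\<ge>1. \<forall>z\<in>W. cmod (dn n z) \<le> C * \<delta> ^ n) \<and>
    (\<forall>n\<ge>1. \<forall>z\<in>W.
       integrable P (\<lambda>\<omega>. exp (z * complex_of_real (partial_sum f U n \<omega>))) \<and>
       prob_space.expectation P (\<lambda>\<omega>. exp (z * complex_of_real (partial_sum f U n \<omega>)))
         = exp (of_nat n * Pi z) * (u z + dn n z))"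
proof -
  interpret transfer_operator_setting B nrm mu P L h0 U
    by (rule setting)
  define S where "S n = partial_sum f U n" for n
  define a where "a n z = P.expectation (\<lambda>\<omega>. exp (z * complex_of_real (S n \<omega>)))" for n z
  define T where "T = twisted_op L f"
  define N where "N z = (\<lambda>g x. T z g x - (\<integral>y. g y \<partial>mu) * h0 x)" for z
  \<comment> \<open>The index is shifted by one: \<open>A (Suc n) z\<close> is the expectation for
    \<open>S n\<close>, and \<open>A 0 z = 1\<close> is the start of the renewal sequence.\<close>
  define A where "A n z = (if n = 0 then 1 else \<integral>x. (T z ^^ (n - 1)) h0 x \<partial>mu)" for n z
  have T0: "T 0 = L"
    by (auto simp: T_def twisted_op_def)
  have T_op: "bounded_op B nrm (T z)" if "z \<in> V" for z
    using twisted_analytic that by (simp add: op_analytic_on_def T_def)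
  have unique: "\<forall>l g. cmod l = 1 \<longrightarrow> eigenfunction B L l g \<longrightarrow> (\<exists>c. g = (\<lambda>x. c * h0 x))"
    using unique_eigenfunction by blast
  obtain \<theta> \<eta> where \<theta>: "0 < \<theta>" "\<theta> < 1" and \<eta>: "0 < \<eta>"
    and small: "\<And>T k. bounded_op B nrm T \<Longrightarrow> (\<And>g. g \<in> B \<Longrightarrow> nrm (\<lambda>x. T g x - L g x) \<le> \<eta> * nrm g) \<Longrightarrow> k \<ge> 1 \<Longrightarrow>
      cmod (\<integral>x. ((\<lambda>g x. T g x - (\<integral>y. g y \<partial>mu) * h0 x) ^^ k) h0 x \<partial>mu) \<le> (1 - \<theta>)\<^sup>2 / 2 * \<theta> ^ (3 * k)"
    by (rule renewal_coefficients_small[OF quasi radius unique]) blast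
  obtain r M where r: "r > 0" "M > 0" "ball 0 r \<subseteq> V"
    and lip: "\<And>z g. z \<in> ball 0 r \<Longrightarrow> g \<in> B \<Longrightarrow> nrm (\<lambda>x. T z g x - L g x) \<le> cmod z * M * nrm g"
    using op_analytic_lipschitz[OF twisted_analytic V_nhd] unfolding T_def[symmetric] T0 by auto
  \<comment> \<open>The bound \<open>t < r\<close> keeps even the boundary points \<open>t\<close>
    and \<open>- t\<close> in \<open>V\<close>, where exponential moments are needed;
    \<open>t * M \<le> \<eta>\<close> puts every twisted operator on \<open>W\<close> within the
    allowed distance of \<open>L\<close>.\<close>
  define t where "t = min (r / 2) (\<eta> / M)"
  have t: "t > 0" "t < r" "t * M \<le> \<eta>"
    using r \<eta> by (auto simp: t_def min_def field_simps)
  define W where "W = ball (0::complex) t"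
  have W: "open W" "0 \<in> W" "W \<subseteq> V"
    using t r by (auto simp: W_def subset_iff)
  have exp_mem: "(\<lambda>x. exp (z * complex_of_real (f x))) \<in> B" if "z \<in> V" for z
    using twisted_well_defined[OF that const_mem[of 1]] by simp
  have S_int: "integrable P (\<lambda>\<omega>. exp (z * complex_of_real (S n \<omega>)))" if "z \<in> V" for z n
    unfolding S_def by (rule twisted_expectation(1)[OF exp_mem[OF that]])
  have S_real_int: "integrable P (\<lambda>\<omega>. exp (s * S n \<omega>))" if "complex_of_real s \<in> V" for s n
    using integrable_Re[OF S_int[OF that, of n]] by (simp add: exp_of_real flip: of_real_mult)
  have tV: "complex_of_real t \<in> V" "complex_of_real (- t) \<in> V"
    using t r(3) by (auto simp: subset_iff)
  have S_rv: "S n \<in> borel_measurable P" for n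
    unfolding S_def by (rule partial_sum_measurable[OF f_mem])
  note mgf = P.moment_generating_function[OF S_rv t(1) S_real_int[OF tV(1)] S_real_int[OF tV(2)]]
  have a_hol: "a n holomorphic_on W" for n
    using mgf(1)[of n] by (simp add: a_def[abs_def] W_def)
  have a_deriv: "(deriv ^^ k) (a n) 0 = of_real (P.expectation (\<lambda>\<omega>. S n \<omega> ^ k))" for n k
    using mgf(3)[of k n] by (simp add: a_def[abs_def])
  have A_a: "A (Suc n) z = a n z" if "z \<in> V" for n z
    using twisted_expectation(2)[OF exp_mem[OF that], of n] by (simp add: A_def a_def S_def T_def)
  have a_0: "a n 0 = 1" for n
    by (simp add: a_def P.prob_space)
  have A_hol: "A n holomorphic_on W" for n
  proof (cases n)
    case 0
    then have "A n = (\<lambda>z. 1)"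
      by (auto simp: A_def)
    then show ?thesis by simp
  next
    case (Suc m)
    show ?thesis
      unfolding Suc by (rule holomorphic_transform[OF a_hol[of m]]) (use A_a W in auto)
  qed
  have rec: "A (Suc n) z = (\<Sum>k\<le>n. (\<integral>x. (N z ^^ k) h0 x \<partial>mu) * A (n - k) z)" if "z \<in> W" for n z
    using funpow_renewal(2)[OF T_op, of z n] that W(3) unfolding A_def N_def by blast
  have near: "nrm (\<lambda>x. T z g x - L g x) \<le> \<eta> * nrm g" if z: "z \<in> W" and g: "g \<in> B" for z g
  proof -
    have "cmod z * M \<le> t * M"
      using z r(2) by (intro mult_right_mono) (auto simp: W_def)
    then have "cmod z * M * nrm g \<le> \<eta> * nrm g"
      using t(3) nrm_nonneg[OF g] by (intro mult_right_mono) auto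
    then show ?thesis
      using lip[of z g] z t g by (auto simp: W_def)
  qed
  \<comment> \<open>The constants \<open>\<theta>\<close> and \<open>\<eta>\<close> were fixed
    before the operator, so one decay rate serves all \<open>z\<close> in \<open>W\<close>.\<close>
  have b_small: "cmod (\<integral>x. (N z ^^ k) h0 x \<partial>mu) \<le> (1 - \<theta>)\<^sup>2 / 2 * \<theta> ^ (3 * k)" if "z \<in> W" "k \<ge> 1" for z k
    unfolding N_def using that W(3) by (intro small T_op near) auto
  have A_0: "A n 0 = 1" for n
    using A_a[OF V_nhd(2)] a_0 by (cases n) (auto simp: A_def)
  have A_start: "A 0 z = 1" and b_start: "(\<integral>x. (N z ^^ 0) h0 x \<partial>mu) = 1" for z
    by (simp_all add: A_def h0_mu)
  obtain Pi u dn C where exp: "Pi holomorphic_on W" "u holomorphic_on W" "\<And>n. dn n holomorphic_on W"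
      "C > 0" "Pi 0 = 0" "u 0 = 1" "\<And>n z. z \<in> W \<Longrightarrow> cmod (dn n z) \<le> C * \<theta> ^ n"
      "\<And>n z. z \<in> W \<Longrightarrow> A (Suc n) z = exp (of_nat n * Pi z) * (u z + dn n z)"
    by (rule renewal_expansion[where A = A and b = "\<lambda>k z. \<integral>x. (N z ^^ k) h0 x \<partial>mu",
          OF W(1,2) A_hol A_start rec b_start b_small \<theta> A_0]) (assumption | rule that; simp)+
  have a_exp: "a n z = exp (of_nat n * Pi z) * (u z + dn n z)" if "z \<in> W" for n z
    using exp(8)[OF that, of n] A_a[of z n] that W(3) by auto
  \<comment> \<open>The derivatives of \<open>a n\<close> at 0 are the moments of
    \<open>S n\<close>, so the variance is exactly the combination in
    \<open>second_deriv_exp_family\<close>.\<close>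
  have "P.variance (S n) = P.expectation (\<lambda>\<omega>. S n \<omega> ^ 2) - (P.expectation (S n))\<^sup>2" for n
    using mgf(2)[of n 1] mgf(2)[of n 2] by (intro P.variance_eq) auto
  then have var: "((deriv ^^ 2) (a n) 0 - (deriv (a n) 0)\<^sup>2) / of_nat n
      = complex_of_real (P.variance (S n) / real n)" for n
    using a_deriv[of 2 n] a_deriv[of 1 n] by simp
  have dn_bound: "cmod (dn n z) \<le> C" if "z \<in> W" for n z
    using order_trans[OF exp(7)[OF that] mult_left_mono[of "\<theta> ^ n" 1 C]] \<theta> exp(4)
    by (simp add: power_le_one)
  have "(\<lambda>n. ((deriv ^^ 2) (a n) 0 - (deriv (a n) 0)\<^sup>2) / of_nat n) \<longlonglongrightarrow> complex_of_real (\<sigma>\<^sup>2)"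
    unfolding var S_def by (intro tendsto_of_real variance_limit)
  from second_deriv_exp_family[OF W(1,2) exp(1-3) dn_bound exp(5) a_exp a_0 this]
  have Pi2: "(deriv ^^ 2) Pi 0 = complex_of_real (\<sigma>\<^sup>2)" .
  show ?thesis
  proof (rule exI[of _ W], rule exI[of _ Pi], rule exI[of _ u], rule exI[of _ dn], rule exI[of _ C],
      rule exI[of _ \<theta>], intro conjI ballI allI impI)
    show "(deriv ^^ 2) Pi 0 \<in> \<real>" "Re ((deriv ^^ 2) Pi 0) > 0"
      unfolding Pi2 using variance_pos by (simp_all only: Reals_of_real Re_complex_of_real)
    fix n z assume z: "z \<in> W"
    show "integrable P (\<lambda>\<omega>. exp (z * complex_of_real (partial_sum f U n \<omega>)))"
      using S_int[of z n] z W(3) by (auto simp: S_def)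
    show "P.expectation (\<lambda>\<omega>. exp (z * complex_of_real (partial_sum f U n \<omega>)))
        = exp (of_nat n * Pi z) * (u z + dn n z)"
      using a_exp[OF z, of n] by (simp add: a_def S_def)
  qed (use W exp \<theta> in \<open>auto simp: analytic_on_open\<close>)
qed

end
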